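(* Let $q\in\mathbb{C}^*$ be generic. Let $H\in M_n(\mathbb{Z})$ be a skew-symmetric matrix of rank $r$ in canonical form with non-degenerate part $\Lambda(\underline{m})$, that is, $H=\begin{pmatrix}\Lambda(\underline{m})&0\\0&0\end{pmatrix}$. Then the automorphism group of the quasi Laurent polynomial algebra $\mathcal{L}_q[H]$ (with generators $y_1^{\pm1},\dots,y_n^{\pm1}$) is $$\mathrm{Aut}(\mathcal{L}_q[H])=\left\{\tau_{\underline{c}}\,\tau_M \mid \underline{c}\in(\mathbb{C}^* )^n,\ M\in Q(\underline{m},\mathbb{Z})\right\},$$ where for $\underline{c}=(c_1,\dots,c_n)^T\in(\mathbb{C}^* )^n$ and $M=(\alpha_1,\dots,\alpha_n)\in Q(\underline{m},\mathbb{Z})$ (with columns $\alpha_i\in\mathbb{Z}^n$) the automorphisms $\tau_{\underline{c}}$ and $\tau_M$ are defined by $$\tau_{\underline{c}}(y_i)=c_iy_i,\qquad \tau_M(y_i)=y^{\alpha_i},\qquad i=1,\dots,n.$$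
   Context: Generic means that $q$ is not a root of unity. For a skew-symmetric $H=(h_{ij})\in M_n(\mathbb{Z})$ and $q\in\mathbb{C}^*$, $\mathcal{L}_q[H]$ is the associative unital $\mathbb{C}$-algebra generated by $y_1,\dots,y_n$ and their inverses $y_1^{-1},\dots,y_n^{-1}$ with relations $y_iy_j=q^{h_{ij}}y_jy_i$ for all $i,j$. For $\alpha=(a_1,\dots,a_n)^T\in\mathbb{Z}^n$, $y^{\alpha}=y_1^{a_1}y_2^{a_2}\cdots y_n^{a_n}$; these Laurent monomials form a basis. Automorphisms are $\mathbb{C}$-algebra automorphisms. Let $S=\begin{pmatrix}0&1\\-1&0\end{pmatrix}$, and let $\underline{m}=(m_1,\dots,m_N)$ be a sequence of positive integers $m_1\le m_2\le\cdots\le m_N$ with $2N=r$. Put $\Lambda(\underline{m})=\mathrm{diag}(m_1S,m_2S,\dots,m_NS)$ (block diagonal, $r\times r$). $\mathrm{GL}_k(\mathbb{Z})$ is the group of integer $k\times k$ matrices with determinant $\pm1$. $\mathrm{Sp}(\underline{m},\mathbb{C})$ is the group of $A\in\mathrm{GL}_r(\mathbb{C})$ with $A^T\Lambda(\underline{m})A=\Lambda(\underline{m})$. $Q(\underline{m},\mathbb{C})$ is the group of block matrices $\begin{pmatrix}A&0\\C&D\end{pmatrix}\in\mathrm{GL}_n(\mathbb{C})$ with $A\in\mathrm{Sp}(\underline{m},\mathbb{C})$, $D\in\mathrm{GL}_{n-r}(\mathbb{C})$, $C\in M_{(n-r)\times r}(\mathbb{C})$, and $Q(\underline{m},\mathbb{Z})=Q(\underline{m},\mathbb{C})\cap\mathrm{GL}_n(\mathbb{Z})$.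 *)

theory Defs
  imports
    "HOL-Algebra.QuotRing"
    "HOL-Algebra.Module"
    "Jordan_Normal_Form.Matrix"
    "Jordan_Normal_Form.Determinant"
    "Jordan_Normal_Form.DL_Rank"
begin

section \<open>Complex algebras by generators and relations\<close>

text \<open>
  A complex algebra is a record of type \<^typ>\<open>(complex, 'b) module\<close>: a ring together with a
  scalar multiplication. (The library's locale \<^locale>\<open>algebra\<close> demands a commutative ring and
  is therefore not used.)

  The elements of the free algebra on \<open>X\<close> are the finitely supported functions from words over
  \<open>X\<close> to the complex numbers; its product extends concatenation of words bilinearly, so the
  coefficient of a word is a sum over all ways to cut it in two.
\<close>

definition free_algebra :: "'x set \<Rightarrow> (complex, 'x list \<Rightarrow> complex) module" where
  "free_algebra X =
    \<lparr>carrier = {f. finite {w. f w \<noteq> 0} \<and> {w. f w \<noteq> 0} \<subseteq> lists X},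
     mult = (\<lambda>f g w. \<Sum>k\<le>length w. f (take k w) * g (drop k w)),
     one = (\<lambda>w. if w = [] then 1 else 0),
     zero = (\<lambda>w. 0),
     add = (\<lambda>f g w. f w + g w),
     smult = (\<lambda>c f w. c * f w)\<rparr>"

definition word :: "'x list \<Rightarrow> 'x list \<Rightarrow> complex" where
  "word u = (\<lambda>w. if w = u then 1 else 0)"

definition quotient_algebra ::
  "(complex, 'b) module \<Rightarrow> 'b set \<Rightarrow> (complex, 'b set) module" where
  "quotient_algebra A I =
    ring.extend (A Quot I) (module.fields (\<lambda>c U. \<Union>u\<in>U. I +>\<^bsub>A\<^esub> (c \<odot>\<^bsub>A\<^esub> u)))"

text \<open>
  Automorphisms are maps on the carrier; \<^const>\<open>extensional\<close> fixes their value outside of it, so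
  that two automorphisms are equal as HOL functions iff they agree on the carrier. For the same
  reason they are composed by \<^const>\<open>compose\<close> on the carrier.
\<close>

definition algebra_Aut :: "(complex, 'b) module \<Rightarrow> ('b \<Rightarrow> 'b) set" where
  "algebra_Aut A =
    {\<phi> \<in> extensional (carrier A). \<phi> \<in> ring_iso A A \<and>
       (\<forall>c. \<forall>x\<in>carrier A. \<phi> (c \<odot>\<^bsub>A\<^esub> x) = c \<odot>\<^bsub>A\<^esub> \<phi> x)}"


section \<open>Quasi Laurent polynomial algebras\<close>

text \<open>
  Indices run over \<open>0, \<dots>, n - 1\<close>, where \<open>n\<close> is the size of \<open>H\<close>.
\<close>

datatype letter = Y nat | Yinv nat

definition letters :: "nat \<Rightarrow> letter set" where
  "letters n = Y ` {..<n} \<union> Yinv ` {..<n}"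

definition laurent_relators ::
  "complex \<Rightarrow> int mat \<Rightarrow> (letter list \<Rightarrow> complex) set" where
  "laurent_relators q H =
    (let n = dim_row H; F = free_algebra (letters n) in
      {word [Y i, Yinv i] \<ominus>\<^bsub>F\<^esub> \<one>\<^bsub>F\<^esub> | i. i < n} \<union>
      {word [Yinv i, Y i] \<ominus>\<^bsub>F\<^esub> \<one>\<^bsub>F\<^esub> | i. i < n} \<union>
      {word [Y i, Y j] \<ominus>\<^bsub>F\<^esub> ((q powi (H $$ (i, j))) \<odot>\<^bsub>F\<^esub> word [Y j, Y i]) | i j. i < n \<and> j < n})"

definition laurent_ideal ::
  "complex \<Rightarrow> int mat \<Rightarrow> (letter list \<Rightarrow> complex) set" where
  "laurent_ideal q H = Idl\<^bsub>free_algebra (letters (dim_row H))\<^esub> (laurent_relators q H)"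

definition quasi_laurent ::
  "complex \<Rightarrow> int mat \<Rightarrow> (complex, (letter list \<Rightarrow> complex) set) module" where
  "quasi_laurent q H =
    quotient_algebra (free_algebra (letters (dim_row H))) (laurent_ideal q H)"

definition laurent_gen ::
  "complex \<Rightarrow> int mat \<Rightarrow> nat \<Rightarrow> (letter list \<Rightarrow> complex) set" where
  "laurent_gen q H i =
    laurent_ideal q H +>\<^bsub>free_algebra (letters (dim_row H))\<^esub> word [Y i]"

definition laurent_monomial ::
  "complex \<Rightarrow> int mat \<Rightarrow> int vec \<Rightarrow> (letter list \<Rightarrow> complex) set" where
  "laurent_monomial q H \<alpha> =
    (let L = quasi_laurent q H in
      foldr (\<lambda>i u. (laurent_gen q H i [^]\<^bsub>L\<^esub> (\<alpha> $ i)) \<otimes>\<^bsub>L\<^esub> u) [0..<dim_row H] \<one>\<^bsub>L\<^esub>)"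


section \<open>Matrix groups\<close>

definition GL_C :: "nat \<Rightarrow> complex mat set" where
  "GL_C k = {A \<in> carrier_mat k k. invertible_mat A}"

definition GL_Z :: "nat \<Rightarrow> int mat set" where
  "GL_Z k = {A \<in> carrier_mat k k. det A = 1 \<or> det A = - 1}"

definition S_mat :: "int mat" where
  "S_mat = mat_of_rows_list 2 [[0, 1], [- 1, 0]]"

definition Lambda :: "int list \<Rightarrow> int mat" where
  "Lambda ms = diag_block_mat (map (\<lambda>m. m \<cdot>\<^sub>m S_mat) ms)"

definition Sp_C :: "int list \<Rightarrow> complex mat set" where
  "Sp_C ms =
    {A \<in> GL_C (2 * length ms).
       transpose_mat A * map_mat of_int (Lambda ms) * A = map_mat of_int (Lambda ms)}"

definition Q_C :: "nat \<Rightarrow> int list \<Rightarrow> complex mat set" where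
  "Q_C n ms =
    (let r = 2 * length ms in
      {four_block_mat A (0\<^sub>m r (n - r)) C D | A C D.
         A \<in> Sp_C ms \<and> C \<in> carrier_mat (n - r) r \<and> D \<in> GL_C (n - r)} \<inter> GL_C n)"

definition Q_Z :: "nat \<Rightarrow> int list \<Rightarrow> int mat set" where
  "Q_Z n ms = {M \<in> GL_Z n. map_mat of_int M \<in> Q_C n ms}"


section \<open>Torus and monomial automorphisms\<close>

definition complex_torus :: "nat \<Rightarrow> complex vec set" where
  "complex_torus n = {c \<in> carrier_vec n. \<forall>i<n. c $ i \<noteq> 0}"

definition is_tau_torus ::
  "complex \<Rightarrow> int mat \<Rightarrow> complex vec \<Rightarrow>
    ((letter list \<Rightarrow> complex) set \<Rightarrow> (letter list \<Rightarrow> complex) set) \<Rightarrow> bool" where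
  "is_tau_torus q H c \<phi> \<longleftrightarrow>
    \<phi> \<in> algebra_Aut (quasi_laurent q H) \<and>
    (\<forall>i<dim_row H. \<phi> (laurent_gen q H i) = (c $ i) \<odot>\<^bsub>quasi_laurent q H\<^esub> laurent_gen q H i)"

definition is_tau_mat ::
  "complex \<Rightarrow> int mat \<Rightarrow> int mat \<Rightarrow>
    ((letter list \<Rightarrow> complex) set \<Rightarrow> (letter list \<Rightarrow> complex) set) \<Rightarrow> bool" where
  "is_tau_mat q H M \<phi> \<longleftrightarrow>
    \<phi> \<in> algebra_Aut (quasi_laurent q H) \<and>
    (\<forall>i<dim_row H. \<phi> (laurent_gen q H i) = laurent_monomial q H (col M i))"

text \<open>
  The definite descriptions below are meaningful only where exactly one such automorphism
  exists; for the parameters considered this is part of the theorem.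
\<close>

definition tau_torus ::
  "complex \<Rightarrow> int mat \<Rightarrow> complex vec \<Rightarrow>
    (letter list \<Rightarrow> complex) set \<Rightarrow> (letter list \<Rightarrow> complex) set" where
  "tau_torus q H c = (THE \<phi>. is_tau_torus q H c \<phi>)"

definition tau_mat ::
  "complex \<Rightarrow> int mat \<Rightarrow> int mat \<Rightarrow>
    (letter list \<Rightarrow> complex) set \<Rightarrow> (letter list \<Rightarrow> complex) set" where
  "tau_mat q H M = (THE \<phi>. is_tau_mat q H M \<phi>)"

end

(*
  The units of the algebra are exactly the non-zero scalar multiples of Laurent monomials. An
  automorphism therefore sends each y_i to a multiple of a monomial y^(alpha_i), and the exponents
  are the columns of a matrix M, which is invertible over the integers because the inverse
  automorphism has such a matrix too. The monomials y^a and y^b commute up to the factor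
  q^(a^T H b); since q is not a root of unity, comparing these factors gives M^T H M = H.
  For canonical H of this shape, H being non-degenerate on the first block, these M are exactly
  the elements of Q(m, Z). Conversely, every such M, with any scalars, respects the defining
  relations and so yields an automorphism. Finally, an automorphism with matrix M composed with
  the inverse of tau_M sends each y_i to a multiple of itself, so it is a torus automorphism.

  Linear independence of the monomials comes from letting the algebra act by weighted shifts on
  functions on the lattice of exponents.
*)

theory Submission
  imports Defs
begin

section \<open>Algebras and homomorphisms\<close>

text \<open>Reordering the factors of a monomial costs powers of q that depend on all the exponents.
  They are never computed: \<open>prop_to\<close> discards non-zero scalars, \<open>qcomm\<close>
  keeps only the commutation exponent, and both are compatible with products, inverses and powers.
  Modulo scalars an endomorphism acts on exponents as an integer matrix; scalars return only through
  the torus, once a composite is known to be diagonal. For the same reason the endomorphism attached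
  to \<open>M\<close> is not proved bijective by exhibiting its inverse: the one attached to the
  inverse matrix inverts it only up to a diagonal map, and diagonal maps are inverted by reciprocal
  scalars.

  The claim about units rests on extreme exponents, but no order on the whole lattice is built: the
  finitely many exponents in play are compared by reading them as polynomials and evaluating at a
  suitable integer.

  For the matrices, the block equation A^T Lambda B = 0 contained in M^T H M = H is what kills the
  upper right block B, because the determinant of A^T Lambda is non-zero.\<close>

locale calgebra = ring A for A :: "(complex, 'b) module" (structure) +
  assumes smult_closed [simp, intro]: "x \<in> carrier A \<Longrightarrow> c \<odot> x \<in> carrier A"
    and smult_1 [simp]: "x \<in> carrier A \<Longrightarrow> 1 \<odot> x = x"
    and smult_smult: "x \<in> carrier A \<Longrightarrow> c \<odot> (d \<odot> x) = (c * d) \<odot> x"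
    and smult_l_distr: "x \<in> carrier A \<Longrightarrow> (c + d) \<odot> x = c \<odot> x \<oplus> d \<odot> x"
    and smult_r_distr: "x \<in> carrier A \<Longrightarrow> y \<in> carrier A \<Longrightarrow> c \<odot> (x \<oplus> y) = c \<odot> x \<oplus> c \<odot> y"
    and smult_mult_left: "x \<in> carrier A \<Longrightarrow> y \<in> carrier A \<Longrightarrow> (c \<odot> x) \<otimes> y = c \<odot> (x \<otimes> y)"
    and smult_mult_right: "x \<in> carrier A \<Longrightarrow> y \<in> carrier A \<Longrightarrow> x \<otimes> (c \<odot> y) = c \<odot> (x \<otimes> y)"
begin

lemma smult_0 [simp]:
  assumes "x \<in> carrier A"
  shows "0 \<odot> x = \<zero>"
proof -
  have "0 \<odot> x = 0 \<odot> x \<oplus> 0 \<odot> x"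
    using smult_l_distr[OF assms, of 0 0] by simp
  then show ?thesis
    using assms by (metis smult_closed add.l_cancel_one' zero_closed)
qed

lemma smult_zero [simp]: "c \<odot> \<zero> = \<zero>"
  by (metis smult_0 smult_smult zero_closed mult_zero_right)

lemma smult_minus_one: "x \<in> carrier A \<Longrightarrow> (-1) \<odot> x = \<ominus> x"
  using smult_l_distr[of x "-1" 1] by (simp add: minus_equality)

text \<open>The vectors form an indexed family and not a set, so that a homomorphism can be applied
  termwise even if it identifies some of them.\<close>

definition lincomb :: "'i set \<Rightarrow> ('i \<Rightarrow> complex) \<Rightarrow> ('i \<Rightarrow> 'b) \<Rightarrow> 'b" where
  "lincomb S c v = (\<Oplus>i\<in>S. c i \<odot> v i)"

lemma lincomb_closed [simp]: "v \<in> S \<rightarrow> carrier A \<Longrightarrow> lincomb S c v \<in> carrier A"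
  unfolding lincomb_def by (rule finsum_closed) auto

lemma lincomb_empty [simp]: "lincomb {} c v = \<zero>"
  by (simp add: lincomb_def)

lemma lincomb_insert:
  assumes "finite S" "i \<notin> S" "v \<in> insert i S \<rightarrow> carrier A"
  shows "lincomb (insert i S) c v = c i \<odot> v i \<oplus> lincomb S c v"
  unfolding lincomb_def using assms by (intro finsum_insert) auto

lemma lincomb_cong:
  assumes "\<And>i. i \<in> S \<Longrightarrow> c i = d i" "\<And>i. i \<in> S \<Longrightarrow> v i = w i" "v \<in> S \<rightarrow> carrier A"
  shows "lincomb S c v = lincomb S d w"
  unfolding lincomb_def using assms by (intro finsum_cong') (auto simp: Pi_iff)

lemma lincomb_mono_neutral:
  assumes "finite T" "S \<subseteq> T" "\<And>i. i \<in> T - S \<Longrightarrow> c i = 0" "v \<in> T \<rightarrow> carrier A"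
  shows "lincomb S c v = lincomb T c v"
  unfolding lincomb_def using assms
  by (intro add.finprod_mono_neutral_cong_left) (auto simp: Pi_iff)

lemma lincomb_add:
  assumes "v \<in> S \<rightarrow> carrier A"
  shows "lincomb S (\<lambda>i. c i + d i) v = lincomb S c v \<oplus> lincomb S d v"
proof -
  have "lincomb S (\<lambda>i. c i + d i) v = (\<Oplus>i\<in>S. c i \<odot> v i \<oplus> d i \<odot> v i)"
    unfolding lincomb_def using assms by (intro finsum_cong') (auto simp: Pi_iff smult_l_distr)
  then show ?thesis
    unfolding lincomb_def using assms by (subst (asm) finsum_addf) auto
qed

lemma lincomb_smult:
  assumes "finite S" "v \<in> S \<rightarrow> carrier A"
  shows "lincomb S (\<lambda>i. k * c i) v = k \<odot> lincomb S c v"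
  using assms
  by (induction S rule: finite_induct) (auto simp: lincomb_insert smult_r_distr smult_smult)

end

definition alg_hom :: "(complex, 'a) module \<Rightarrow> (complex, 'b) module \<Rightarrow> ('a \<Rightarrow> 'b) \<Rightarrow> bool" where
  "alg_hom A B h \<longleftrightarrow> h \<in> Ring.ring_hom A B \<and> (\<forall>c. \<forall>x\<in>carrier A. h (c \<odot>\<^bsub>A\<^esub> x) = c \<odot>\<^bsub>B\<^esub> h x)"

lemma alg_homD:
  assumes "alg_hom A B h"
  shows "x \<in> carrier A \<Longrightarrow> h x \<in> carrier B"
    and "x \<in> carrier A \<Longrightarrow> y \<in> carrier A \<Longrightarrow> h (x \<otimes>\<^bsub>A\<^esub> y) = h x \<otimes>\<^bsub>B\<^esub> h y"
    and "x \<in> carrier A \<Longrightarrow> y \<in> carrier A \<Longrightarrow> h (x \<oplus>\<^bsub>A\<^esub> y) = h x \<oplus>\<^bsub>B\<^esub> h y"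
    and "h \<one>\<^bsub>A\<^esub> = \<one>\<^bsub>B\<^esub>"
    and "x \<in> carrier A \<Longrightarrow> h (c \<odot>\<^bsub>A\<^esub> x) = c \<odot>\<^bsub>B\<^esub> h x"
  using assms ring_hom_memE[of h A B] unfolding alg_hom_def by auto

lemma alg_hom_comp:
  assumes "alg_hom A B h" "alg_hom B C g"
  shows "alg_hom A C (\<lambda>x. g (h x))"
  unfolding alg_hom_def
  by (intro conjI ring_hom_memI) (simp_all add: alg_homD[OF assms(1)] alg_homD[OF assms(2)])

lemma alg_hom_zero:
  assumes "calgebra A" "calgebra B" "alg_hom A B h"
  shows "h \<zero>\<^bsub>A\<^esub> = \<zero>\<^bsub>B\<^esub>"
proof -
  interpret A: calgebra A by fact
  interpret B: calgebra B by fact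
  have "h (0 \<odot>\<^bsub>A\<^esub> \<zero>\<^bsub>A\<^esub>) = 0 \<odot>\<^bsub>B\<^esub> h \<zero>\<^bsub>A\<^esub>"
    by (rule alg_homD(5)[OF assms(3)]) simp
  then show ?thesis
    using alg_homD(1)[OF assms(3), of "\<zero>\<^bsub>A\<^esub>"] by simp
qed

lemma alg_hom_lincomb:
  assumes "calgebra A" "calgebra B" "alg_hom A B h" "finite S" "v \<in> S \<rightarrow> carrier A"
  shows "h (calgebra.lincomb A S c v) = calgebra.lincomb B S c (\<lambda>i. h (v i))"
proof -
  interpret A: calgebra A by fact
  interpret B: calgebra B by fact
  note hom = alg_homD[OF assms(3)]
  show ?thesis
    using assms(4,5)
  proof (induction S rule: finite_induct)
    case empty
    then show ?case using alg_hom_zero[OF assms(1-3)] by simp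
  next
    case (insert i S)
    then have "v i \<in> carrier A" "v \<in> S \<rightarrow> carrier A" by auto
    with insert show ?case
      by (auto simp: A.lincomb_insert B.lincomb_insert hom Pi_iff)
  qed
qed

section \<open>The free algebra\<close>

text \<open>The product of \<open>free_algebra\<close>, detached from the alphabet: bilinearity then
  holds for arbitrary functions, without support conditions.\<close>

definition wconv :: "('x list \<Rightarrow> complex) \<Rightarrow> ('x list \<Rightarrow> complex) \<Rightarrow> 'x list \<Rightarrow> complex" where
  "wconv f g w = (\<Sum>k\<le>length w. f (take k w) * g (drop k w))"

lemma free_algebra_simps:
  "carrier (free_algebra X) = {f. finite {w. f w \<noteq> 0} \<and> {w. f w \<noteq> 0} \<subseteq> lists X}"
  "f \<otimes>\<^bsub>free_algebra X\<^esub> g = wconv f g"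
  "f \<oplus>\<^bsub>free_algebra X\<^esub> g = (\<lambda>w. f w + g w)"
  "\<one>\<^bsub>free_algebra X\<^esub> = word []"
  "\<zero>\<^bsub>free_algebra X\<^esub> = (\<lambda>w. 0)"
  "c \<odot>\<^bsub>free_algebra X\<^esub> f = (\<lambda>w. c * f w)"
  by (auto simp: free_algebra_def wconv_def word_def)

lemma wconv_add_left: "wconv (\<lambda>w. f w + f' w) g = (\<lambda>w. wconv f g w + wconv f' g w)"
  by (auto simp: wconv_def sum.distrib ring_distribs)

lemma wconv_add_right: "wconv f (\<lambda>w. g w + g' w) = (\<lambda>w. wconv f g w + wconv f g' w)"
  by (auto simp: wconv_def sum.distrib ring_distribs)

lemma wconv_smult_left: "wconv (\<lambda>w. c * f w) g = (\<lambda>w. c * wconv f g w)"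
  unfolding wconv_def sum_distrib_left by (simp only: mult.assoc)

lemma wconv_smult_right: "wconv f (\<lambda>w. c * g w) = (\<lambda>w. c * wconv f g w)"
  unfolding wconv_def sum_distrib_left by (simp only: mult.left_commute)

text \<open>A cut contributes only if its left piece is \<open>u\<close>, which fixes the cut
  position as \<open>length u\<close>; the sum over all cuts collapses to one term.\<close>

lemma wconv_word: "wconv (word u) (word v) = word (u @ v)"
proof
  fix w :: "'a list"
  have "word u (take k w) * word v (drop k w) =
      (if k = length u then (if w = u @ v then 1 else 0) else 0)" if "k \<le> length w" for k
  proof (cases "take k w = u \<and> drop k w = v")
    case True
    then have "w = u @ v" using append_take_drop_id[of k w] by metis
    moreover have "length (take k w) = k" using that by simp
    then have "k = length u" using True by metis
    ultimately show ?thesis by (simp add: word_def)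
  next
    case False
    then have "\<not> (k = length u \<and> w = u @ v)" by auto
    then show ?thesis using False by (cases "k = length u"; cases "take k w = u") (auto simp: word_def)
  qed
  then have "wconv (word u) (word v) w =
      (\<Sum>k\<le>length w. if k = length u then (if w = u @ v then 1 else 0) else 0)"
    unfolding wconv_def by (intro sum.cong) simp_all
  also have "\<dots> = word (u @ v) w"
    by (cases "w = u @ v") (simp_all add: word_def)
  finally show "wconv (word u) (word v) w = word (u @ v) w" .
qed

lemma word_in_free_algebra [simp]: "u \<in> lists X \<Longrightarrow> word u \<in> carrier (free_algebra X)"
  by (auto simp: free_algebra_simps word_def)

lemma free_algebra_add_closed:
  assumes "f \<in> carrier (free_algebra X)" "g \<in> carrier (free_algebra X)"
  shows "(\<lambda>w. f w + g w) \<in> carrier (free_algebra X)"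
proof -
  have "{w. f w + g w \<noteq> 0} \<subseteq> {w. f w \<noteq> 0} \<union> {w. g w \<noteq> 0}" by auto
  with assms show ?thesis
    unfolding free_algebra_simps using finite_subset by fastforce
qed

lemma free_algebra_smult_closed:
  assumes "f \<in> carrier (free_algebra X)"
  shows "(\<lambda>w. c * f w) \<in> carrier (free_algebra X)"
proof -
  have "{w. c * f w \<noteq> 0} \<subseteq> {w. f w \<noteq> 0}" by auto
  with assms show ?thesis
    unfolding free_algebra_simps using finite_subset by fastforce
qed

text \<open>Every element is a finite linear combination of words. Multilinear identities can
  therefore be checked on words, one argument at a time.\<close>

lemma free_algebra_induct [consumes 1, case_names word add smult]:
  assumes "f \<in> carrier (free_algebra X)"
    and word: "\<And>u. u \<in> lists X \<Longrightarrow> P (word u)"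
    and add: "\<And>f g. f \<in> carrier (free_algebra X) \<Longrightarrow> g \<in> carrier (free_algebra X) \<Longrightarrow>
      P f \<Longrightarrow> P g \<Longrightarrow> P (\<lambda>w. f w + g w)"
    and smult: "\<And>c f. f \<in> carrier (free_algebra X) \<Longrightarrow> P f \<Longrightarrow> P (\<lambda>w. c * f w)"
  shows "P f"
proof -
  \<comment> \<open>The zero function is the multiple by 0 of the empty word, so it needs no premise
    of its own.\<close>
  have zero: "P (\<lambda>w. 0)"
    using smult[of "word []" 0] word[of "[]"] by simp
  have "finite S \<Longrightarrow> S \<subseteq> lists X \<Longrightarrow> {w. f w \<noteq> 0} \<subseteq> S \<Longrightarrow> P f" for S f
  proof (induction S arbitrary: f rule: finite_induct)
    case empty
    then have "f = (\<lambda>w. 0)" by auto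
    then show ?case using zero by simp
  next
    case (insert u S)
    \<comment> \<open>Splits one word off the support; the remainder is covered by the induction
      hypothesis.\<close>
    define g where "g = f(u := 0)"
    have g_supp: "{w. g w \<noteq> 0} \<subseteq> S"
      using insert.prems unfolding g_def by auto
    have u: "u \<in> lists X" using insert.prems by auto
    have "P g" using insert.IH[of g] g_supp insert.prems by auto
    moreover have "g \<in> carrier (free_algebra X)"
      unfolding free_algebra_simps using g_supp insert finite_subset by auto
    moreover have "P (\<lambda>w. f u * word u w)"
      using smult[OF _ word[OF u]] u by simp
    moreover have "(\<lambda>w. f u * word u w) \<in> carrier (free_algebra X)"
      using u by (intro free_algebra_smult_closed) simp
    ultimately have "P (\<lambda>w. g w + f u * word u w)" by (intro add)
    moreover have "f = (\<lambda>w. g w + f u * word u w)"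
      by (rule ext) (simp add: g_def word_def)
    ultimately show ?case by (simp only:)
  qed
  then show ?thesis using assms(1) by (auto simp: free_algebra_simps)
qed

lemma wconv_closed:
  assumes "f \<in> carrier (free_algebra X)" "g \<in> carrier (free_algebra X)"
  shows "wconv f g \<in> carrier (free_algebra X)"
  using assms(1)
proof (induction rule: free_algebra_induct)
  case (word u)
  show ?case using assms(2)
  proof (induction rule: free_algebra_induct)
    case (word v)
    with \<open>u \<in> lists X\<close> show ?case by (simp add: wconv_word)
  qed (simp_all add: wconv_add_right wconv_smult_right free_algebra_add_closed
      free_algebra_smult_closed)
qed (simp_all add: wconv_add_left wconv_smult_left free_algebra_add_closed
    free_algebra_smult_closed)

text \<open>Three nested inductions, one per factor, leave only associativity of
  concatenation.\<close>

lemma wconv_assoc: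
  assumes "f \<in> carrier (free_algebra X)" "g \<in> carrier (free_algebra X)"
    "h \<in> carrier (free_algebra X)"
  shows "wconv (wconv f g) h = wconv f (wconv g h)"
  using assms(1)
proof (induction rule: free_algebra_induct)
  case (word u)
  show ?case using assms(2)
  proof (induction rule: free_algebra_induct)
    case (word v)
    show ?case using assms(3)
      by (induction rule: free_algebra_induct)
        (simp_all add: wconv_word wconv_add_right wconv_smult_right)
  qed (simp_all add: wconv_add_right wconv_smult_right wconv_add_left wconv_smult_left)
qed (simp_all add: wconv_add_left wconv_smult_left)

lemma wconv_one:
  assumes "f \<in> carrier (free_algebra X)"
  shows "wconv (word []) f = f" "wconv f (word []) = f"
  using assms
  by (induction rule: free_algebra_induct)
    (simp_all add: wconv_word wconv_add_right wconv_smult_right wconv_add_left wconv_smult_left)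

lemma abelian_group_free_algebra: "abelian_group (free_algebra X)"
proof (rule abelian_groupI)
  fix f assume "f \<in> carrier (free_algebra X)"
  then have "(\<lambda>w. -1 * f w) \<in> carrier (free_algebra X)"
    by (rule free_algebra_smult_closed)
  then show "\<exists>y\<in>carrier (free_algebra X). y \<oplus>\<^bsub>free_algebra X\<^esub> f = \<zero>\<^bsub>free_algebra X\<^esub>"
    by (rule bexI[rotated]) (simp add: free_algebra_simps(3,5))
next
  show "\<zero>\<^bsub>free_algebra X\<^esub> \<in> carrier (free_algebra X)"
    by (simp add: free_algebra_simps(1,5))
qed (simp_all only: free_algebra_simps(3,5) free_algebra_add_closed ac_simps add_0)

lemma ring_free_algebra: "ring (free_algebra X)"
proof (rule ringI)
  show "abelian_group (free_algebra X)" by (rule abelian_group_free_algebra)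
  show "monoid (free_algebra X)"
  proof (rule monoidI)
    show "\<one>\<^bsub>free_algebra X\<^esub> \<in> carrier (free_algebra X)"
      by (simp add: free_algebra_simps(4))
  qed (simp_all only: free_algebra_simps(2,4) wconv_closed wconv_assoc wconv_one)
qed (simp_all only: free_algebra_simps(2,3) wconv_add_left wconv_add_right)

lemma calgebra_free_algebra: "calgebra (free_algebra X)"
proof (intro calgebra.intro calgebra_axioms.intro ring_free_algebra)
  fix f assume "f \<in> carrier (free_algebra X)"
  then show "c \<odot>\<^bsub>free_algebra X\<^esub> f \<in> carrier (free_algebra X)" for c
    unfolding free_algebra_simps(6) by (rule free_algebra_smult_closed)
qed (simp_all only: free_algebra_simps(2-) wconv_smult_left wconv_smult_right ring_distribs
      mult.assoc mult_1)

section \<open>Evaluation homomorphisms on the free algebra\<close>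

context calgebra
begin

definition wprod :: "('x \<Rightarrow> 'b) \<Rightarrow> 'x list \<Rightarrow> 'b" where
  "wprod g w = foldr (\<lambda>x y. g x \<otimes> y) w \<one>"

lemma wprod_simps [simp]: "wprod g [] = \<one>" "wprod g (x # w) = g x \<otimes> wprod g w"
  by (simp_all add: wprod_def)

lemma wprod_closed: "g \<in> X \<rightarrow> carrier A \<Longrightarrow> w \<in> lists X \<Longrightarrow> wprod g w \<in> carrier A"
  by (induction w) auto

lemma wprod_append:
  "g \<in> X \<rightarrow> carrier A \<Longrightarrow> u \<in> lists X \<Longrightarrow> v \<in> lists X \<Longrightarrow>
    wprod g (u @ v) = wprod g u \<otimes> wprod g v"
proof (induction u)
  case (Cons x u)
  then have "g x \<in> carrier A" "wprod g u \<in> carrier A" "wprod g v \<in> carrier A"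
    by (auto intro: wprod_closed)
  with Cons show ?case by (simp add: m_assoc)
qed (simp add: wprod_closed)

definition free_ev :: "('x \<Rightarrow> 'b) \<Rightarrow> ('x list \<Rightarrow> complex) \<Rightarrow> 'b" where
  "free_ev g f = lincomb {w. f w \<noteq> 0} f (wprod g)"

text \<open>The support varies with the element. Any finite superset may be summed over instead, so
  that two elements can be evaluated over a common index set.\<close>

lemma free_ev_eq:
  assumes "g \<in> X \<rightarrow> carrier A" "finite S" "S \<subseteq> lists X" "{w. f w \<noteq> 0} \<subseteq> S"
  shows "free_ev g f = lincomb S f (wprod g)"
proof -
  have "wprod g \<in> S \<rightarrow> carrier A" using wprod_closed[OF assms(1)] assms(3) by blast
  then show ?thesis
    unfolding free_ev_def using assms(2,4) by (intro lincomb_mono_neutral) auto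
qed

lemma free_ev_word:
  assumes "g \<in> X \<rightarrow> carrier A" "u \<in> lists X"
  shows "free_ev g (word u) = wprod g u"
proof -
  have "free_ev g (word u) = lincomb {u} (word u) (wprod g)"
    using assms by (intro free_ev_eq[where X = X]) (auto simp: word_def)
  also have "\<dots> = wprod g u"
    using wprod_closed[OF assms] by (subst lincomb_insert) (auto simp: word_def)
  finally show ?thesis .
qed

lemma free_ev_add:
  assumes "g \<in> X \<rightarrow> carrier A" "f \<in> carrier (free_algebra X)" "h \<in> carrier (free_algebra X)"
  shows "free_ev g (\<lambda>w. f w + h w) = free_ev g f \<oplus> free_ev g h"
proof -
  let ?S = "{w. f w \<noteq> 0} \<union> {w. h w \<noteq> 0}"
  have S: "finite ?S" "?S \<subseteq> lists X" using assms by (auto simp: free_algebra_simps)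
  have "wprod g \<in> ?S \<rightarrow> carrier A" using S(2) wprod_closed[OF assms(1)] by blast
  moreover have "free_ev g k = lincomb ?S k (wprod g)" if "{w. k w \<noteq> 0} \<subseteq> ?S" for k
    using free_ev_eq[OF assms(1) S that] .
  moreover have "{w. f w + h w \<noteq> 0} \<subseteq> ?S" by auto
  ultimately show ?thesis by (simp only: lincomb_add Un_upper1 Un_upper2)
qed

lemma free_ev_smult:
  assumes "g \<in> X \<rightarrow> carrier A" "f \<in> carrier (free_algebra X)"
  shows "free_ev g (\<lambda>w. c * f w) = c \<odot> free_ev g f"
proof -
  let ?S = "{w. f w \<noteq> 0}"
  have S: "finite ?S" "?S \<subseteq> lists X" using assms by (auto simp: free_algebra_simps)
  have "wprod g \<in> ?S \<rightarrow> carrier A" using S(2) wprod_closed[OF assms(1)] by blast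
  moreover have "free_ev g k = lincomb ?S k (wprod g)" if "{w. k w \<noteq> 0} \<subseteq> ?S" for k
    using free_ev_eq[OF assms(1) S that] .
  moreover have "{w. c * f w \<noteq> 0} \<subseteq> ?S" by auto
  ultimately show ?thesis by (simp only: lincomb_smult S subset_refl)
qed

lemma free_ev_closed:
  assumes "g \<in> X \<rightarrow> carrier A" "f \<in> carrier (free_algebra X)"
  shows "free_ev g f \<in> carrier A"
proof -
  have "wprod g \<in> {w. f w \<noteq> 0} \<rightarrow> carrier A"
    using wprod_closed[OF assms(1)] assms(2) unfolding free_algebra_simps(1) by blast
  then show ?thesis
    unfolding free_ev_def by (rule lincomb_closed)
qed

text \<open>Both sides are bilinear in \<open>f\<close> and \<open>h\<close>; on a pair of words the
  claim is \<open>wprod_append\<close>.\<close>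

lemma free_ev_mult:
  assumes g: "g \<in> X \<rightarrow> carrier A"
    and f: "f \<in> carrier (free_algebra X)" and h: "h \<in> carrier (free_algebra X)"
  shows "free_ev g (wconv f h) = free_ev g f \<otimes> free_ev g h"
  using f
proof (induction rule: free_algebra_induct)
  case (word u)
  then have u: "word u \<in> carrier (free_algebra X)" by simp
  show ?case using h
  proof (induction rule: free_algebra_induct)
    case (word v)
    with \<open>u \<in> lists X\<close> have "u @ v \<in> lists X" by simp
    from free_ev_word[OF g this] free_ev_word[OF g \<open>u \<in> lists X\<close>] free_ev_word[OF g \<open>v \<in> lists X\<close>]
      wprod_append[OF g \<open>u \<in> lists X\<close> \<open>v \<in> lists X\<close>]
    show ?case by (simp only: wconv_word)
  next
    case (add f k)
    then show ?case
      by (simp add: wconv_add_right free_ev_add[OF g] wconv_closed u free_ev_closed[OF g] r_distr)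
  next
    case (smult c f)
    then show ?case
      by (simp add: wconv_smult_right free_ev_smult[OF g] wconv_closed u free_ev_closed[OF g]
          smult_mult_right)
  qed
next
  case (add f k)
  then show ?case
    by (simp add: wconv_add_left free_ev_add[OF g] wconv_closed h free_ev_closed[OF g] l_distr)
next
  case (smult c f)
  then show ?case
    by (simp add: wconv_smult_left free_ev_smult[OF g] wconv_closed h free_ev_closed[OF g]
        smult_mult_left)
qed

text \<open>Existence half of the universal property of the free algebra.\<close>

lemma free_ev_alg_hom:
  assumes "g \<in> X \<rightarrow> carrier A"
  shows "alg_hom (free_algebra X) A (free_ev g)"
  unfolding alg_hom_def
  by (intro conjI ring_hom_memI)
    (simp_all add: free_algebra_simps(2-) free_ev_closed[OF assms] free_ev_mult[OF assms]
      free_ev_add[OF assms] free_ev_smult[OF assms] free_ev_word[OF assms])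

end

section \<open>Quotient algebras\<close>

lemma quotient_algebra_simps:
  "carrier (quotient_algebra A I) = carrier (A Quot I)"
  "U \<otimes>\<^bsub>quotient_algebra A I\<^esub> V = U \<otimes>\<^bsub>A Quot I\<^esub> V"
  "U \<oplus>\<^bsub>quotient_algebra A I\<^esub> V = U \<oplus>\<^bsub>A Quot I\<^esub> V"
  "\<one>\<^bsub>quotient_algebra A I\<^esub> = \<one>\<^bsub>A Quot I\<^esub>"
  "\<zero>\<^bsub>quotient_algebra A I\<^esub> = \<zero>\<^bsub>A Quot I\<^esub>"
  "c \<odot>\<^bsub>quotient_algebra A I\<^esub> U = (\<Union>u\<in>U. I +>\<^bsub>A\<^esub> (c \<odot>\<^bsub>A\<^esub> u))"
  by (simp_all add: quotient_algebra_def ring.defs module.defs)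

lemma ring_quotient_algebra:
  assumes "ideal I A"
  shows "ring (quotient_algebra A I)"
proof -
  interpret Q: ring "A Quot I" using assms by (rule ideal.quotient_is_ring)
  show ?thesis
  proof (rule ringI)
    show "abelian_group (quotient_algebra A I)"
      by (rule abelian_groupI)
        (simp_all add: quotient_algebra_simps(1-5) Q.a_ac Q.add.l_inv_ex)
    show "monoid (quotient_algebra A I)"
      by (rule monoidI) (simp_all add: quotient_algebra_simps(1-5) Q.m_assoc)
  qed (simp_all add: quotient_algebra_simps(1-5) Q.l_distr Q.r_distr)
qed

context calgebra
begin

text \<open>Well-definedness: the union over representatives in \<open>quotient_algebra\<close> is a
  union of equal cosets.\<close>

lemma quotient_smult:
  assumes "ideal I A" "x \<in> carrier A"
  shows "c \<odot>\<^bsub>quotient_algebra A I\<^esub> (I +> x) = I +> (c \<odot> x)"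
proof -
  interpret I: ideal I A by fact
  \<comment> \<open>Ideals are only ring ideals, but in a unital algebra they are stable under
    scalars, as \<open>c\<close> times \<open>i\<close> is the product of \<open>c\<close> times one
    with \<open>i\<close>.\<close>
  have sm: "c \<odot> i \<in> I" if "i \<in> I" for i
  proof -
    have "i \<in> carrier A" using that I.Icarr by simp
    then have "c \<odot> i = (c \<odot> \<one>) \<otimes> i" by (simp add: smult_mult_left)
    then show ?thesis using that I.I_l_closed by simp
  qed
  have "I +> (c \<odot> u) = I +> (c \<odot> x)" if "u \<in> I +> x" for u
  proof -
    from that obtain i where i: "i \<in> I" "u = i \<oplus> x" by (auto simp: a_r_coset_def')
    then have "c \<odot> u = c \<odot> i \<oplus> c \<odot> x" using assms(2) I.Icarr by (simp add: smult_r_distr)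
    then have "c \<odot> u \<in> I +> (c \<odot> x)" using sm[OF i(1)] by (auto simp: a_r_coset_def')
    then show ?thesis using I.a_repr_independence' assms(2) by simp
  qed
  moreover have "x \<in> I +> x" using I.a_rcos_self assms(2) by simp
  ultimately show ?thesis unfolding quotient_algebra_simps by blast
qed

lemma quotient_carrier: "carrier (quotient_algebra A I) = (\<lambda>x. I +> x) ` carrier A"
  by (auto simp: quotient_algebra_simps FactRing_def A_RCOSETS_def')

lemma quotient_proj_hom:
  assumes "ideal I A"
  shows "alg_hom A (quotient_algebra A I) (\<lambda>x. I +> x)"
proof -
  interpret I: ideal I A by fact
  have "(\<lambda>x. I +> x) \<in> Ring.ring_hom A (A Quot I)" by (rule I.rcos_ring_hom)
  then show ?thesis
    unfolding alg_hom_def using quotient_smult[OF assms]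
    by (auto simp: Ring.ring_hom_def quotient_algebra_simps(1-5))
qed

lemma calgebra_quotient:
  assumes "ideal I A"
  shows "calgebra (quotient_algebra A I)"
proof -
  note p = alg_homD(2-)[OF quotient_proj_hom[OF assms], symmetric]
  have "calgebra_axioms (quotient_algebra A I)"
    unfolding calgebra_axioms_def quotient_carrier
    by (auto simp: p smult_smult smult_l_distr smult_r_distr smult_mult_left smult_mult_right)
  then show ?thesis
    using ring_quotient_algebra[OF assms] by (rule calgebra.intro[rotated])
qed

text \<open>The kernel of \<open>h\<close> is an ideal containing \<open>R\<close>, hence it
  contains the ideal generated by \<open>R\<close>, and \<open>h\<close> factors through the
  quotient.\<close>

lemma quotient_hom_exists:
  assumes "calgebra B" and h: "alg_hom A B h"
    and R: "R \<subseteq> carrier A" "\<And>x. x \<in> R \<Longrightarrow> h x = \<zero>\<^bsub>B\<^esub>"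
  obtains k where "alg_hom (quotient_algebra A (Idl R)) B k"
    "\<And>x. x \<in> carrier A \<Longrightarrow> k (Idl R +> x) = h x"
proof -
  interpret B: calgebra B by fact
  have "ring_hom_ring A B h"
    using ring_hom_ringI2[OF ring_axioms B.ring_axioms] h unfolding alg_hom_def by blast
  then interpret h: ring_hom_ring A B h .
  interpret I: ideal "Idl R" A by (rule genideal_ideal[OF R(1)])
  have "Idl R \<subseteq> a_kernel A B h"
    using R unfolding a_kernel_def' by (intro genideal_minimal h.kernel_is_ideal[unfolded a_kernel_def']) blast
  then have ker: "h i = \<zero>\<^bsub>B\<^esub>" if "i \<in> Idl R" for i
    using that unfolding a_kernel_def' by blast
  \<comment> \<open>Any representative will do: two of them differ by an element of the ideal, on
    which \<open>h\<close> vanishes.\<close>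
  define k where "k U = h (SOME x. x \<in> U)" for U
  have k: "k (Idl R +> x) = h x" if "x \<in> carrier A" for x
  proof -
    have "x \<in> Idl R +> x" using I.a_rcos_self that by simp
    then have "(SOME y. y \<in> Idl R +> x) \<in> Idl R +> x" by (rule someI)
    then obtain i where i: "i \<in> Idl R" "(SOME y. y \<in> Idl R +> x) = i \<oplus> x"
      unfolding a_r_coset_def' by blast
    then have "k (Idl R +> x) = h i \<oplus>\<^bsub>B\<^esub> h x"
      unfolding k_def i(2) by (intro h.hom_add I.Icarr[OF i(1)] that)
    then show ?thesis using h.hom_closed[OF that] by (simp only: ker[OF i(1)] B.l_zero)
  qed
  note p = alg_homD(2-)[OF quotient_proj_hom[OF I.ideal_axioms], symmetric]
  note hh = alg_homD[OF h]
  have "\<forall>x\<in>carrier A. k (Idl R +> x) \<in> carrier B"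
    using k hh(1) by metis
  moreover have "\<forall>x\<in>carrier A. \<forall>y\<in>carrier A.
      k ((Idl R +> x) \<otimes>\<^bsub>quotient_algebra A (Idl R)\<^esub> (Idl R +> y)) = k (Idl R +> x) \<otimes>\<^bsub>B\<^esub> k (Idl R +> y)"
    by (intro ballI) (simp only: p k hh m_closed)
  moreover have "\<forall>x\<in>carrier A. \<forall>y\<in>carrier A.
      k ((Idl R +> x) \<oplus>\<^bsub>quotient_algebra A (Idl R)\<^esub> (Idl R +> y)) = k (Idl R +> x) \<oplus>\<^bsub>B\<^esub> k (Idl R +> y)"
    by (intro ballI) (simp only: p k hh a_closed)
  moreover have "k \<one>\<^bsub>quotient_algebra A (Idl R)\<^esub> = \<one>\<^bsub>B\<^esub>"
    by (simp only: p k hh one_closed)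
  moreover have "\<forall>x\<in>carrier A. k (c \<odot>\<^bsub>quotient_algebra A (Idl R)\<^esub> (Idl R +> x)) = c \<odot>\<^bsub>B\<^esub> k (Idl R +> x)" for c
    by (intro ballI) (simp only: p k hh smult_closed)
  ultimately have "alg_hom (quotient_algebra A (Idl R)) B k"
    unfolding alg_hom_def Ring.ring_hom_def quotient_carrier by blast
  with k show thesis using that by blast
qed

end

section \<open>Monomials in q-commuting units\<close>

context monoid
begin

lemma Units_nat_pow_closed [intro]: "x \<in> Units G \<Longrightarrow> x [^] (m::nat) \<in> Units G"
  by (induction m) auto

text \<open>Bridge to the group of units, where the laws of integer exponents hold;
  \<open>Units_int_pow_add\<close> pulls additivity back through it.\<close>

lemma units_of_int_pow:
  assumes "x \<in> Units G"
  shows "x [^]\<^bsub>units_of G\<^esub> (k::int) = x [^] k"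
  unfolding int_pow_def2 units_of_pow[OF assms] using units_of_inv[OF Units_nat_pow_closed[OF assms]]
  by (simp only:)

lemma Units_int_pow_closed [intro]: "x \<in> Units G \<Longrightarrow> x [^] (k::int) \<in> Units G"
  unfolding int_pow_def2 using Units_nat_pow_closed Units_inv_Units by presburger

lemma Units_int_pow_carrier [intro]: "x \<in> Units G \<Longrightarrow> x [^] (k::int) \<in> carrier G"
  by (intro Units_closed Units_int_pow_closed)

lemma Units_int_pow_add:
  assumes "x \<in> Units G"
  shows "x [^] (k + l) = x [^] k \<otimes> x [^] (l::int)"
  using group.int_pow_mult[OF units_group, of x k l] assms
  by (simp add: units_of_carrier units_of_mult units_of_int_pow)

lemma Units_int_pow_1: "x \<in> Units G \<Longrightarrow> x [^] (1::int) = x"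
  unfolding int_pow_def2 by (simp add: Units_closed)

lemma Units_int_pow_minus_1: "x \<in> Units G \<Longrightarrow> x [^] (-1::int) = inv x"
  unfolding int_pow_def2 by (simp add: Units_closed)

end

section \<open>Proportionality and q-commutation\<close>

context calgebra
begin

lemma smult_Units:
  assumes "c \<noteq> 0" "x \<in> Units A"
  shows "c \<odot> x \<in> Units A"
proof -
  have x: "x \<in> carrier A" "inv x \<in> carrier A" using assms(2) by auto
  have "(c \<odot> x) \<otimes> (inverse c \<odot> inv x) = \<one>" "(inverse c \<odot> inv x) \<otimes> (c \<odot> x) = \<one>"
    using x assms by (simp_all add: smult_mult_left smult_mult_right smult_smult)
  then show ?thesis using x unfolding Units_def by blast
qed

text \<open>Products of monomials are monomials only in this sense. The scalar must be non-zero for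
  the relation to be symmetric.\<close>

definition prop_to :: "'b \<Rightarrow> 'b \<Rightarrow> bool" where
  "prop_to x y \<longleftrightarrow> (\<exists>c. c \<noteq> 0 \<and> x = c \<odot> y)"

lemma prop_to_refl: "x \<in> carrier A \<Longrightarrow> prop_to x x"
  unfolding prop_to_def by (intro exI[of _ 1]) simp

lemma prop_to_sym:
  assumes "y \<in> carrier A" "prop_to x y"
  shows "prop_to y x"
proof -
  obtain c where "c \<noteq> 0" "x = c \<odot> y" using assms unfolding prop_to_def by auto
  then show ?thesis
    unfolding prop_to_def using assms(1) by (intro exI[of _ "inverse c"]) (simp add: smult_smult)
qed

lemma prop_to_trans:
  assumes "z \<in> carrier A" "prop_to x y" "prop_to y z"
  shows "prop_to x z"
proof -
  obtain c d where "c \<noteq> 0" "x = c \<odot> y" "d \<noteq> 0" "y = d \<odot> z"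
    using assms unfolding prop_to_def by auto
  then show ?thesis
    unfolding prop_to_def using assms(1) by (intro exI[of _ "c * d"]) (simp add: smult_smult)
qed

lemma prop_to_smult: "c \<noteq> 0 \<Longrightarrow> prop_to (c \<odot> x) x"
  unfolding prop_to_def by blast

lemma prop_to_mult:
  assumes "y \<in> carrier A" "y' \<in> carrier A" "prop_to x y" "prop_to x' y'"
  shows "prop_to (x \<otimes> x') (y \<otimes> y')"
proof -
  obtain c d where "c \<noteq> 0" "x = c \<odot> y" "d \<noteq> 0" "x' = d \<odot> y'"
    using assms unfolding prop_to_def by auto
  then show ?thesis
    unfolding prop_to_def using assms(1,2)
    by (intro exI[of _ "c * d"]) (simp add: smult_smult smult_mult_left smult_mult_right mult.commute)
qed

definition qcomm :: "complex \<Rightarrow> int \<Rightarrow> 'b \<Rightarrow> 'b \<Rightarrow> bool" where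
  "qcomm q k x y \<longleftrightarrow> x \<otimes> y = (q powi k) \<odot> (y \<otimes> x)"

lemma qcomm_prop_to: "q \<noteq> 0 \<Longrightarrow> qcomm q k x y \<Longrightarrow> prop_to (x \<otimes> y) (y \<otimes> x)"
  unfolding qcomm_def by (simp add: prop_to_smult)

lemma qcomm_sym:
  assumes "q \<noteq> 0" "x \<in> carrier A" "y \<in> carrier A" "qcomm q k x y"
  shows "qcomm q (-k) y x"
proof -
  have "(q powi (-k)) \<odot> (x \<otimes> y) = (q powi (-k) * q powi k) \<odot> (y \<otimes> x)"
    using assms unfolding qcomm_def by (simp add: smult_smult)
  also have "q powi (-k) * q powi k = 1"
    using assms(1) by (simp add: power_int_minus)
  finally show ?thesis using assms by (simp add: qcomm_def)
qed

lemma qcomm_one: "x \<in> carrier A \<Longrightarrow> qcomm q 0 x \<one>"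
  by (simp add: qcomm_def)

text \<open>Moving \<open>x\<close> past \<open>y\<close> and then past \<open>z\<close> multiplies
  the two factors, so the exponents add. This is the source of the bilinear form on
  exponents.\<close>

lemma qcomm_mult:
  assumes "q \<noteq> 0" "x \<in> carrier A" "y \<in> carrier A" "z \<in> carrier A"
    "qcomm q k x y" "qcomm q l x z"
  shows "qcomm q (k + l) x (y \<otimes> z)"
proof -
  have "x \<otimes> (y \<otimes> z) = (q powi k \<odot> (y \<otimes> x)) \<otimes> z"
    using assms unfolding qcomm_def by (metis m_assoc)
  also have "\<dots> = q powi k \<odot> (y \<otimes> (x \<otimes> z))"
    using assms by (simp add: smult_mult_left m_assoc)
  also have "x \<otimes> z = q powi l \<odot> (z \<otimes> x)"
    using assms unfolding qcomm_def by simp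
  finally show ?thesis
    using assms by (simp add: qcomm_def smult_mult_right smult_smult power_int_add m_assoc)
qed

text \<open>Multiplying the relation by \<open>inv y\<close> on both sides exchanges the roles of
  the two factors and keeps \<open>k\<close>; turning it around by \<open>qcomm_sym\<close> changes
  the sign.\<close>

lemma qcomm_inv:
  assumes "q \<noteq> 0" "x \<in> carrier A" "y \<in> Units A" "qcomm q k x y"
  shows "qcomm q (-k) x (inv y)"
proof -
  have y: "y \<in> carrier A" "inv y \<in> carrier A" using assms by auto
  have "inv y \<otimes> (x \<otimes> y) \<otimes> inv y = inv y \<otimes> (q powi k \<odot> (y \<otimes> x)) \<otimes> inv y"
    using assms(4) unfolding qcomm_def by simp
  moreover have "inv y \<otimes> (x \<otimes> y) \<otimes> inv y = inv y \<otimes> x"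
    using assms y by (simp add: m_assoc)
  moreover have "inv y \<otimes> (q powi k \<odot> (y \<otimes> x)) \<otimes> inv y = q powi k \<odot> (x \<otimes> inv y)"
    using assms y by (simp add: smult_mult_right smult_mult_left m_assoc[symmetric])
  ultimately have "qcomm q k (inv y) x" unfolding qcomm_def by simp
  then show ?thesis using qcomm_sym assms y by blast
qed

lemma qcomm_int_pow:
  assumes q: "q \<noteq> 0" and x: "x \<in> carrier A" and y: "y \<in> Units A" and "qcomm q k x y"
  shows "qcomm q (m * k) x (y [^] (m::int))"
proof -
  have yc: "y \<in> carrier A" using y by auto
  have nat: "qcomm q (int m * k) x (y [^] m)" for m :: nat
  proof (induction m)
    case 0
    show ?case using x qcomm_one by simp
  next
    case (Suc m)
    then show ?case
      using qcomm_mult[OF q x _ yc Suc assms(4)] yc by (simp add: algebra_simps)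
  qed
  show ?thesis
  proof (cases "m < 0")
    case True
    then show ?thesis
      using qcomm_inv[OF q x Units_nat_pow_closed[OF y] nat[of "nat (-m)"]]
      unfolding int_pow_def2 by simp
  next
    case False
    then show ?thesis using nat[of "nat m"] unfolding int_pow_def2 by simp
  qed
qed

text \<open>The factors follow an arbitrary index list, so that induction on the list is available;
  \<open>[0..<n]\<close> gives the monomials of the algebra. The family \<open>u\<close> is a
  parameter because images of generators under homomorphisms are treated in the same way.\<close>

definition ordered_monomial :: "(nat \<Rightarrow> 'b) \<Rightarrow> nat list \<Rightarrow> (nat \<Rightarrow> int) \<Rightarrow> 'b" where
  "ordered_monomial u js a = foldr (\<lambda>i x. u i [^] a i \<otimes> x) js \<one>"

lemma ordered_monomial_simps [simp]:
  "ordered_monomial u [] a = \<one>"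
  "ordered_monomial u (j # js) a = u j [^] a j \<otimes> ordered_monomial u js a"
  by (simp_all add: ordered_monomial_def)

lemma ordered_monomial_Units:
  "u \<in> set js \<rightarrow> Units A \<Longrightarrow> ordered_monomial u js a \<in> Units A"
  by (induction js) auto

lemma ordered_monomial_cong:
  "(\<And>j. j \<in> set js \<Longrightarrow> a j = b j) \<Longrightarrow> ordered_monomial u js a = ordered_monomial u js b"
  by (induction js) auto

lemma ordered_monomial_zero:
  "u \<in> set js \<rightarrow> Units A \<Longrightarrow> ordered_monomial u js (\<lambda>_. 0) = \<one>"
  by (induction js) auto

text \<open>Additivity of the commutation exponent, iterated over the factors. Distinctness lets the
  sum run over the set of indices.\<close>

lemma qcomm_ordered_monomial:
  assumes "q \<noteq> 0" "x \<in> carrier A" "u \<in> set js \<rightarrow> Units A"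
    "\<And>j. j \<in> set js \<Longrightarrow> qcomm q (f j) x (u j)" "distinct js"
  shows "qcomm q (\<Sum>j\<in>set js. a j * f j) x (ordered_monomial u js a)"
  using assms(3-5)
proof (induction js)
  case Nil
  show ?case using assms(2) by (simp add: qcomm_one)
next
  case (Cons j js)
  then have u: "u j \<in> Units A" "u \<in> set js \<rightarrow> Units A" by auto
  have "qcomm q (a j * f j + (\<Sum>j\<in>set js. a j * f j)) x (u j [^] a j \<otimes> ordered_monomial u js a)"
    using assms(1,2) u Cons
    by (intro qcomm_mult qcomm_int_pow) (auto intro: Units_closed ordered_monomial_Units)
  then show ?case using Cons.prems by simp
qed

end

text \<open>Units in any algebra that satisfy the defining relations: exactly the data from which a
  homomorphism out of the Laurent algebra is built, and also the setting in which monomials can be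
  calculated with.\<close>

locale qtuple = calgebra A for A :: "(complex, 'b) module" (structure) +
  fixes q :: complex and n :: nat and h :: "nat \<Rightarrow> nat \<Rightarrow> int" and u :: "nat \<Rightarrow> 'b"
  assumes q_nonzero: "q \<noteq> 0"
    and u_Units: "i < n \<Longrightarrow> u i \<in> Units A"
    and u_qcomm: "i < n \<Longrightarrow> j < n \<Longrightarrow> qcomm q (h i j) (u i) (u j)"
begin

abbreviation mon :: "(nat \<Rightarrow> int) \<Rightarrow> 'b" where
  "mon a \<equiv> ordered_monomial u [0..<n] a"

lemma mon_Units [simp, intro]: "mon a \<in> Units A"
  by (rule ordered_monomial_Units) (auto intro: u_Units)

lemma mon_closed [simp, intro]: "mon a \<in> carrier A"
  using mon_Units by (rule Units_closed)

lemma u_closed [simp, intro]: "i < n \<Longrightarrow> u i \<in> carrier A"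
  using u_Units by auto

lemma qcomm_gen_mon:
  assumes "i < n"
  shows "qcomm q (\<Sum>j<n. b j * h i j) (u i) (mon b)"
  using qcomm_ordered_monomial[OF q_nonzero, of "u i" u "[0..<n]" "h i" b] assms
  by (auto simp: u_qcomm u_Units atLeast0LessThan)

text \<open>The exponent is the bilinear form of \<open>h\<close> at \<open>a\<close> and
  \<open>b\<close>. The one-sided statement is used twice: for a generator against
  \<open>mon b\<close>, and, after reversing the relation, for \<open>mon b\<close> against the
  factors of \<open>mon a\<close>. A second reversal restores the sign.\<close>

lemma qcomm_mon_mon: "qcomm q (\<Sum>i<n. \<Sum>j<n. a i * b j * h i j) (mon a) (mon b)"
proof -
  have "qcomm q (- (\<Sum>j<n. b j * h i j)) (mon b) (u i)" if "i < n" for i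
    using that by (intro qcomm_sym q_nonzero qcomm_gen_mon) auto
  then have "qcomm q (\<Sum>i<n. a i * - (\<Sum>j<n. b j * h i j)) (mon b) (mon a)"
    using qcomm_ordered_monomial[OF q_nonzero, of "mon b" u "[0..<n]"
        "\<lambda>i. - (\<Sum>j<n. b j * h i j)" a]
    by (auto simp: u_Units atLeast0LessThan)
  then have "qcomm q (- (\<Sum>i<n. a i * - (\<Sum>j<n. b j * h i j))) (mon a) (mon b)"
    by (intro qcomm_sym q_nonzero) auto
  then show ?thesis by (simp add: sum_negf sum_distrib_left mult.assoc)
qed

text \<open>Sorting factors only produces powers of q. The inner claim \<open>comm\<close> carries
  \<open>u j [^] b j\<close> leftwards through the tail of the first monomial; the two powers of
  \<open>u j\<close> then merge, and the tails are left to the induction hypothesis.\<close>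

lemma ordered_monomial_add:
  assumes "set js \<subseteq> {..<n}"
  shows "prop_to (ordered_monomial u js a \<otimes> ordered_monomial u js b)
    (ordered_monomial u js (\<lambda>i. a i + b i))"
  using assms
proof (induction js)
  case (Cons j js)
  let ?x = "ordered_monomial u js a" and ?y = "ordered_monomial u js b"
  have uj: "u j \<in> Units A" and U: "u \<in> set js \<rightarrow> Units A" using Cons.prems u_Units by auto
  have x: "?x \<in> carrier A" and y: "?y \<in> carrier A" and
    s: "ordered_monomial u js (\<lambda>i. a i + b i) \<in> carrier A"
    using U ordered_monomial_Units by blast+
  have p: "u j [^] a j \<in> carrier A" "u j [^] b j \<in> carrier A" using uj by blast+
  have comm: "prop_to (ordered_monomial u ks a \<otimes> u j [^] b j) (u j [^] b j \<otimes> ordered_monomial u ks a)"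
    if "set ks \<subseteq> {..<n}" for ks
    using that
  proof (induction ks)
    case Nil
    then show ?case using p prop_to_refl by simp
  next
    case (Cons k ks)
    let ?z = "ordered_monomial u ks a"
    have k: "k < n" "u k \<in> Units A" using Cons.prems u_Units by auto
    have pk: "u k [^] a k \<in> carrier A" using k by blast
    have "u \<in> set ks \<rightarrow> Units A" using Cons.prems u_Units by auto
    then have z: "?z \<in> carrier A" using ordered_monomial_Units by blast
    have j: "j < n" using \<open>set (j # js) \<subseteq> {..<n}\<close> by simp
    have "qcomm q (b j * h k j) (u k) (u j [^] b j)"
      using k j uj by (intro qcomm_int_pow q_nonzero u_qcomm) auto
    then have "qcomm q (- (b j * h k j)) (u j [^] b j) (u k)"
      using k p by (intro qcomm_sym q_nonzero) auto
    then have "qcomm q (a k * - (b j * h k j)) (u j [^] b j) (u k [^] a k)"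
      using k p by (intro qcomm_int_pow q_nonzero)
    then have c: "prop_to (u j [^] b j \<otimes> u k [^] a k) (u k [^] a k \<otimes> u j [^] b j)"
      by (rule qcomm_prop_to[OF q_nonzero])
    have "prop_to (u k [^] a k \<otimes> (?z \<otimes> u j [^] b j)) (u k [^] a k \<otimes> (u j [^] b j \<otimes> ?z))"
      by (rule prop_to_mult) (use Cons z p pk in \<open>auto intro: prop_to_refl\<close>)
    moreover have "prop_to ((u k [^] a k \<otimes> u j [^] b j) \<otimes> ?z) ((u j [^] b j \<otimes> u k [^] a k) \<otimes> ?z)"
      using c z p pk by (intro prop_to_mult prop_to_refl prop_to_sym[OF _ c]) auto
    ultimately show ?case
      using z p pk by (auto simp: m_assoc intro: prop_to_trans[rotated])
  qed
  have "prop_to (u j [^] a j \<otimes> ((?x \<otimes> u j [^] b j) \<otimes> ?y)) (u j [^] a j \<otimes> ((u j [^] b j \<otimes> ?x) \<otimes> ?y))"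
    using x y p Cons.prems by (intro prop_to_mult prop_to_refl comm) auto
  moreover have "prop_to ((u j [^] a j \<otimes> u j [^] b j) \<otimes> (?x \<otimes> ?y))
      ((u j [^] a j \<otimes> u j [^] b j) \<otimes> ordered_monomial u js (\<lambda>i. a i + b i))"
    using Cons x y p s by (intro prop_to_mult prop_to_refl) auto
  ultimately have "prop_to (u j [^] a j \<otimes> ((?x \<otimes> u j [^] b j) \<otimes> ?y))
      ((u j [^] a j \<otimes> u j [^] b j) \<otimes> ordered_monomial u js (\<lambda>i. a i + b i))"
    using x y p s by (auto simp: m_assoc intro: prop_to_trans[rotated])
  then show ?case using x y p s by (simp add: m_assoc Units_int_pow_add[OF uj])
qed (simp add: prop_to_refl)

lemma mon_add: "prop_to (mon a \<otimes> mon b) (mon (\<lambda>i. a i + b i))"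
  by (rule ordered_monomial_add) auto

lemma mon_zero: "mon (\<lambda>_. 0) = \<one>"
  by (rule ordered_monomial_zero) (auto intro: u_Units)

lemma mon_unit_scaled:
  assumes "i < n"
  shows "mon (\<lambda>j. if j = i then k else 0) = u i [^] k"
proof -
  have "ordered_monomial u js (\<lambda>j. if j = i then k else 0) =
      (if i \<in> set js then u i [^] k else \<one>)" if "distinct js" "set js \<subseteq> {..<n}" for js
    using that
  proof (induction js)
    case (Cons j js)
    have "u i [^] k \<in> carrier A" using u_Units[OF assms] by blast
    with Cons show ?case by auto
  qed simp
  from this[of "[0..<n]"] show ?thesis using assms by (simp add: atLeast0LessThan)
qed

end

section \<open>The universal property\<close>

lemma (in calgebra) minus_eq_zero_iff:
  assumes "x \<in> carrier A" "y \<in> carrier A"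
  shows "x \<ominus> y = \<zero> \<longleftrightarrow> x = y"
  using minus_equality[of x "\<ominus> y"] assms by (auto simp: minus_eq r_neg)

lemma alg_hom_minus:
  assumes "calgebra A" "calgebra B" "alg_hom A B h" "x \<in> carrier A" "y \<in> carrier A"
  shows "h (x \<ominus>\<^bsub>A\<^esub> y) = h x \<ominus>\<^bsub>B\<^esub> h y"
proof -
  interpret A: calgebra A by fact
  interpret B: calgebra B by fact
  note hom = alg_homD[OF assms(3)]
  have "h (x \<oplus>\<^bsub>A\<^esub> (-1) \<odot>\<^bsub>A\<^esub> y) = h x \<oplus>\<^bsub>B\<^esub> (-1) \<odot>\<^bsub>B\<^esub> h y"
    by (simp only: hom(3,5) A.smult_closed assms(4,5))
  then show ?thesis
    unfolding A.minus_eq B.minus_eq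
    by (simp only: A.smult_minus_one B.smult_minus_one assms(5) hom(1))
qed

locale laurent =
  fixes q :: complex and H :: "int mat" and n :: nat
  assumes q_nonzero: "q \<noteq> 0" and H_dim: "H \<in> carrier_mat n n"
begin

abbreviation F :: "(complex, letter list \<Rightarrow> complex) module" where
  "F \<equiv> free_algebra (letters n)"

abbreviation L :: "(complex, (letter list \<Rightarrow> complex) set) module" where
  "L \<equiv> quasi_laurent q H"

abbreviation gen :: "nat \<Rightarrow> (letter list \<Rightarrow> complex) set" where
  "gen \<equiv> laurent_gen q H"

definition proj :: "(letter list \<Rightarrow> complex) \<Rightarrow> (letter list \<Rightarrow> complex) set" where
  "proj f = laurent_ideal q H +>\<^bsub>F\<^esub> f"

definition gen_inv :: "nat \<Rightarrow> (letter list \<Rightarrow> complex) set" where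
  "gen_inv i = proj (word [Yinv i])"

lemma dim_row_H [simp]: "dim_row H = n"
  using H_dim by auto

sublocale F: calgebra F
  by (rule calgebra_free_algebra)

lemma letters_iff [simp]: "Y i \<in> letters n \<longleftrightarrow> i < n" "Yinv i \<in> letters n \<longleftrightarrow> i < n"
  by (auto simp: letters_def)

lemma relators_closed: "laurent_relators q H \<subseteq> carrier F"
  unfolding laurent_relators_def Let_def dim_row_H by auto

lemma laurent_ideal_eq: "laurent_ideal q H = Idl\<^bsub>F\<^esub> (laurent_relators q H)"
  by (simp add: laurent_ideal_def)

lemma ideal_laurent_ideal: "ideal (laurent_ideal q H) F"
  unfolding laurent_ideal_eq by (rule F.genideal_ideal[OF relators_closed])

lemma L_eq: "L = quotient_algebra F (laurent_ideal q H)"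
  by (simp add: quasi_laurent_def)

sublocale L: calgebra L
  unfolding L_eq by (rule F.calgebra_quotient[OF ideal_laurent_ideal])

lemma proj_hom: "alg_hom F L proj"
  using F.quotient_proj_hom[OF ideal_laurent_ideal] unfolding L_eq proj_def .

lemmas proj_simps = alg_homD[OF proj_hom]

lemma carrier_L: "carrier L = proj ` carrier F"
  unfolding L_eq F.quotient_carrier proj_def by simp

text \<open>Relators are differences of two sides, so this turns each of them into an equation in
  the quotient.\<close>

lemma proj_eqI:
  assumes "f \<in> carrier F" "g \<in> carrier F" "f \<ominus>\<^bsub>F\<^esub> g \<in> laurent_relators q H"
  shows "proj f = proj g"
proof -
  interpret I: ideal "laurent_ideal q H" F by (rule ideal_laurent_ideal)
  have "f \<ominus>\<^bsub>F\<^esub> g \<in> laurent_ideal q H"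
    using assms(3) F.genideal_self[OF relators_closed] unfolding laurent_ideal_eq by blast
  then have "proj (f \<ominus>\<^bsub>F\<^esub> g) = laurent_ideal q H"
    unfolding proj_def by (rule I.a_rcos_const)
  also have "\<dots> = \<zero>\<^bsub>L\<^esub>"
    unfolding L_eq quotient_algebra_simps(5) by (simp add: FactRing_def)
  finally have "proj f \<ominus>\<^bsub>L\<^esub> proj g = \<zero>\<^bsub>L\<^esub>"
    using alg_hom_minus[OF F.calgebra_axioms L.calgebra_axioms proj_hom assms(1,2)] by simp
  then show ?thesis using L.minus_eq_zero_iff proj_simps(1) assms by blast
qed

lemma gen_eq: "gen i = proj (word [Y i])"
  by (simp add: laurent_gen_def proj_def)

lemma gen_closed [simp, intro]: "i < n \<Longrightarrow> gen i \<in> carrier L"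
  unfolding gen_eq by (rule proj_simps(1)) simp

lemma gen_inv_closed [simp, intro]: "i < n \<Longrightarrow> gen_inv i \<in> carrier L"
  unfolding gen_inv_def by (rule proj_simps(1)) simp

lemma proj_word_append:
  assumes "u \<in> lists (letters n)" "v \<in> lists (letters n)"
  shows "proj (word (u @ v)) = proj (word u) \<otimes>\<^bsub>L\<^esub> proj (word v)"
  using proj_simps(2)[of "word u" "word v"] assms
  by (simp only: free_algebra_simps(2) wconv_word word_in_free_algebra)

lemma proj_word_Nil: "proj (word []) = \<one>\<^bsub>L\<^esub>"
  using proj_simps(4) by (simp only: free_algebra_simps(4))

lemma gen_gen_inv: "i < n \<Longrightarrow> gen i \<otimes>\<^bsub>L\<^esub> gen_inv i = \<one>\<^bsub>L\<^esub>"
proof -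
  assume i: "i < n"
  have "proj (word [Y i, Yinv i]) = proj \<one>\<^bsub>F\<^esub>"
    by (rule proj_eqI) (use i in \<open>auto simp: laurent_relators_def Let_def\<close>)
  then show ?thesis
    using proj_word_append[of "[Y i]" "[Yinv i]"] i by (simp add: gen_eq gen_inv_def proj_simps(4))
qed

lemma gen_inv_gen: "i < n \<Longrightarrow> gen_inv i \<otimes>\<^bsub>L\<^esub> gen i = \<one>\<^bsub>L\<^esub>"
proof -
  assume i: "i < n"
  have "proj (word [Yinv i, Y i]) = proj \<one>\<^bsub>F\<^esub>"
    by (rule proj_eqI) (use i in \<open>auto simp: laurent_relators_def Let_def\<close>)
  then show ?thesis
    using proj_word_append[of "[Yinv i]" "[Y i]"] i by (simp add: gen_eq gen_inv_def proj_simps(4))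
qed

lemma gen_Units: "i < n \<Longrightarrow> gen i \<in> Units L"
  using gen_gen_inv gen_inv_gen gen_closed gen_inv_closed unfolding Units_def by blast

lemma inv_gen: "i < n \<Longrightarrow> inv\<^bsub>L\<^esub> gen i = gen_inv i"
  using L.inv_unique'[OF _ _ gen_gen_inv gen_inv_gen] by auto

lemma gen_qcomm:
  assumes "i < n" "j < n"
  shows "L.qcomm q (H $$ (i, j)) (gen i) (gen j)"
proof -
  have "proj (word [Y i, Y j]) = proj ((q powi (H $$ (i, j))) \<odot>\<^bsub>F\<^esub> word [Y j, Y i])"
    by (rule proj_eqI) (use assms in \<open>auto simp: laurent_relators_def Let_def\<close>)
  also have "\<dots> = (q powi (H $$ (i, j))) \<odot>\<^bsub>L\<^esub> proj (word [Y j, Y i])"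
    using assms by (intro proj_simps(5)) simp
  finally show ?thesis
    using proj_word_append[of "[Y i]" "[Y j]"] proj_word_append[of "[Y j]" "[Y i]"] assms
    by (simp add: L.qcomm_def gen_eq)
qed

text \<open>The generators are themselves such a tuple, which opens the monomial calculus inside the
  algebra.\<close>

sublocale L: qtuple L q n "\<lambda>i j. H $$ (i, j)" gen
  by unfold_locales (simp_all add: q_nonzero gen_Units gen_qcomm)

lemma laurent_monomial_eq: "laurent_monomial q H \<alpha> = L.mon (\<lambda>i. \<alpha> $ i)"
  by (simp add: laurent_monomial_def L.ordered_monomial_def Let_def)

text \<open>Existence half of the universal property. Letters are sent to \<open>v i\<close> and to
  the inverses; the evaluation kills all three kinds of relators and so factors through the
  quotient.\<close>

lemma hom_exists:
  assumes "qtuple B q n (\<lambda>i j. H $$ (i, j)) v"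
  obtains k where "alg_hom L B k" "\<And>i. i < n \<Longrightarrow> k (gen i) = v i"
proof -
  interpret B: qtuple B q n "\<lambda>i j. H $$ (i, j)" v by fact
  define g where "g l = (case l of Y i \<Rightarrow> v i | Yinv i \<Rightarrow> inv\<^bsub>B\<^esub> v i)" for l
  have gv: "g (Y i) = v i" "g (Yinv i) = inv\<^bsub>B\<^esub> v i" for i
    by (simp_all add: g_def)
  have g: "g \<in> letters n \<rightarrow> carrier B"
    using B.u_Units by (auto simp: letters_def gv)
  define h where "h = B.free_ev g"
  have hom: "alg_hom F B h"
    unfolding h_def by (rule B.free_ev_alg_hom[OF g])
  have word: "h (word u) = B.wprod g u" if "u \<in> lists (letters n)" for u
    unfolding h_def by (rule B.free_ev_word[OF g that])
  have minus: "h (f \<ominus>\<^bsub>F\<^esub> k) = h f \<ominus>\<^bsub>B\<^esub> h k" if "f \<in> carrier F" "k \<in> carrier F" for f k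
    using alg_hom_minus[OF F.calgebra_axioms B.calgebra_axioms hom that] .
  have hz: "h (f \<ominus>\<^bsub>F\<^esub> k) = \<zero>\<^bsub>B\<^esub>" if "f \<in> carrier F" "k \<in> carrier F" "h f = h k" for f k
    using minus[OF that(1,2)] that B.minus_eq_zero_iff alg_homD(1)[OF hom] by metis
  have one: "h \<one>\<^bsub>F\<^esub> = \<one>\<^bsub>B\<^esub>" by (rule alg_homD(4)[OF hom])
  have "h x = \<zero>\<^bsub>B\<^esub>" if "x \<in> laurent_relators q H" for x
  proof -
    from that consider
      (1) i where "i < n" "x = word [Y i, Yinv i] \<ominus>\<^bsub>F\<^esub> \<one>\<^bsub>F\<^esub>"
      | (2) i where "i < n" "x = word [Yinv i, Y i] \<ominus>\<^bsub>F\<^esub> \<one>\<^bsub>F\<^esub>"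
      | (3) i j where "i < n" "j < n"
          "x = word [Y i, Y j] \<ominus>\<^bsub>F\<^esub> ((q powi (H $$ (i, j))) \<odot>\<^bsub>F\<^esub> word [Y j, Y i])"
      unfolding laurent_relators_def Let_def dim_row_H by blast
    then show ?thesis
    proof cases
      case 1
      then have "h (word [Y i, Yinv i]) = \<one>\<^bsub>B\<^esub>"
        using B.u_Units by (simp add: word gv B.Units_closed)
      with 1 show ?thesis unfolding 1(2) by (intro hz) (simp_all add: one)
    next
      case 2
      then have "h (word [Yinv i, Y i]) = \<one>\<^bsub>B\<^esub>"
        using B.u_Units by (simp add: word gv B.Units_closed)
      with 2 show ?thesis unfolding 2(2) by (intro hz) (simp_all add: one)
    next
      case 3
      have "h ((q powi (H $$ (i, j))) \<odot>\<^bsub>F\<^esub> word [Y j, Y i]) =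
          (q powi (H $$ (i, j))) \<odot>\<^bsub>B\<^esub> (v j \<otimes>\<^bsub>B\<^esub> v i)"
        using 3 by (subst alg_homD(5)[OF hom]) (simp_all add: word gv)
      moreover have "h (word [Y i, Y j]) = v i \<otimes>\<^bsub>B\<^esub> v j"
        using 3 by (simp add: word gv)
      ultimately show ?thesis
        using 3 B.u_qcomm[OF 3(1,2)] unfolding 3(3) B.qcomm_def by (intro hz) simp_all
    qed
  qed
  then obtain k where k: "alg_hom L B k" "\<And>x. x \<in> carrier F \<Longrightarrow> k (proj x) = h x"
    using F.quotient_hom_exists[OF B.calgebra_axioms hom relators_closed]
    unfolding L_eq laurent_ideal_eq proj_def by blast
  have "k (gen i) = v i" if "i < n" for i
    using that k(2)[of "word [Y i]"] by (simp add: gen_eq word gv)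
  with k(1) show thesis using that by blast
qed

section \<open>Uniqueness of homomorphisms and spanning by monomials\<close>

lemma L_induct [consumes 1, case_names word add smult]:
  assumes "x \<in> carrier L"
    and word: "\<And>w. w \<in> lists (letters n) \<Longrightarrow> P (proj (word w))"
    and add: "\<And>x y. x \<in> carrier L \<Longrightarrow> y \<in> carrier L \<Longrightarrow> P x \<Longrightarrow> P y \<Longrightarrow> P (x \<oplus>\<^bsub>L\<^esub> y)"
    and smult: "\<And>c x. x \<in> carrier L \<Longrightarrow> P x \<Longrightarrow> P (c \<odot>\<^bsub>L\<^esub> x)"
  shows "P x"
proof -
  obtain f where f: "f \<in> carrier F" "x = proj f" using assms(1) carrier_L by auto
  have "P (proj f)" using f(1)
  proof (induction rule: free_algebra_induct)
    case (word u)
    then show ?case by (rule assms(2))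
  next
    case (add f g)
    then show ?case
      using assms(3)[of "proj f" "proj g"] proj_simps(1,3)[of f] proj_simps(1)[of g]
      by (simp add: free_algebra_simps(3))
  next
    case (smult c f)
    then show ?case
      using assms(4)[of "proj f" c] proj_simps(1,5)[of f] by (simp add: free_algebra_simps(6))
  qed
  then show ?thesis using f by simp
qed

lemma proj_letter_cases:
  assumes "l \<in> letters n"
  obtains i where "i < n" "proj (word [l]) = gen i" | i where "i < n" "proj (word [l]) = gen_inv i"
  using assms that by (auto simp: letters_def gen_eq gen_inv_def)

text \<open>Inverses are unique, so the values on the generators force those on
  \<open>gen_inv\<close>, then on words, and by linearity everywhere.\<close>

lemma hom_unique:
  assumes B: "calgebra B" and hom: "alg_hom L B k" "alg_hom L B k'"
    and eq: "\<And>i. i < n \<Longrightarrow> k (gen i) = k' (gen i)" and "x \<in> carrier L"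
  shows "k x = k' x"
proof -
  interpret B: calgebra B by fact
  note k = alg_homD[OF hom(1)] and k' = alg_homD[OF hom(2)]
  have inv: "k (gen_inv i) = k' (gen_inv i)" if i: "i < n" for i
  proof (rule B.inv_unique[where x = "k (gen i)"])
    show "k (gen_inv i) \<otimes>\<^bsub>B\<^esub> k (gen i) = \<one>\<^bsub>B\<^esub>"
      using k(2)[of "gen_inv i" "gen i"] k(4) gen_inv_gen[OF i] i by simp
    show "k (gen i) \<otimes>\<^bsub>B\<^esub> k' (gen_inv i) = \<one>\<^bsub>B\<^esub>"
      using k'(2)[of "gen i" "gen_inv i"] k'(4) gen_gen_inv[OF i] i eq by simp
  qed (use i k(1) k'(1) in auto)
  show ?thesis using assms(5)
  proof (induction rule: L_induct)
    case (word w)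
    then show ?case
    proof (induction w)
      case Nil
      show ?case by (simp only: proj_word_Nil k k')
    next
      case (Cons l w)
      then have l: "l \<in> letters n" and w: "w \<in> lists (letters n)" by auto
      have p: "proj (word (l # w)) = proj (word [l]) \<otimes>\<^bsub>L\<^esub> proj (word w)"
        using proj_word_append[of "[l]" w] l w by simp
      have c: "proj (word [l]) \<in> carrier L" "proj (word w) \<in> carrier L"
        using l w by (auto intro!: proj_simps(1) word_in_free_algebra)
      have "k (proj (word [l])) = k' (proj (word [l]))"
        using l by (rule proj_letter_cases) (simp_all add: eq inv)
      with Cons.IH show ?case unfolding p by (simp only: k(2)[OF c] k'(2)[OF c])
    qed
  qed (simp_all only: k(3,5) k'(3,5))
qed

text \<open>Normalised exponents. \<open>L.mon\<close> reads only the values below \<open>n\<close>,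
  so without this condition different functions would name the same monomial.\<close>

definition exps :: "(nat \<Rightarrow> int) set" where
  "exps = {a. \<forall>i\<ge>n. a i = 0}"

lemma mon_restrict: "\<exists>b\<in>exps. L.mon a = L.mon b"
  by (intro bexI[of _ "\<lambda>i. if i < n then a i else 0"] L.ordered_monomial_cong)
    (auto simp: exps_def)

text \<open>A single letter is a monomial whose exponent is plus or minus a unit vector, and
  products of monomials are monomials up to a scalar.\<close>

lemma proj_word_mon:
  assumes "w \<in> lists (letters n)"
  shows "\<exists>a. L.prop_to (proj (word w)) (L.mon a)"
  using assms
proof (induction w)
  case Nil
  then show ?case
    using L.mon_zero proj_word_Nil L.prop_to_refl[OF L.one_closed] by (intro exI[of _ "\<lambda>_. 0"]) simp
next
  case (Cons l w)
  then have l: "l \<in> letters n" and w: "w \<in> lists (letters n)" by auto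
  have p: "proj (word (l # w)) = proj (word [l]) \<otimes>\<^bsub>L\<^esub> proj (word w)"
    using proj_word_append[of "[l]" w] l w by simp
  obtain a where a: "L.prop_to (proj (word w)) (L.mon a)" using Cons.IH by blast
  have "\<exists>b. proj (word [l]) = L.mon b"
    using l
  proof (rule proj_letter_cases)
    fix i assume "i < n" "proj (word [l]) = gen i"
    then show ?thesis
      using L.mon_unit_scaled[of i 1] L.Units_int_pow_1[OF gen_Units[of i]] by metis
  next
    fix i assume "i < n" "proj (word [l]) = gen_inv i"
    then show ?thesis
      using L.mon_unit_scaled[of i "-1"] L.Units_int_pow_minus_1[OF gen_Units[of i]] inv_gen[of i]
      by metis
  qed
  then obtain b where "proj (word [l]) = L.mon b" by blast
  then have "L.prop_to (proj (word (l # w))) (L.mon b \<otimes>\<^bsub>L\<^esub> L.mon a)"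
    unfolding p using L.prop_to_mult[OF _ _ L.prop_to_refl a] by simp
  then show ?case using L.prop_to_trans[OF _ _ L.mon_add] by blast
qed

lemma L_span:
  assumes "x \<in> carrier L"
  obtains S c where "finite S" "S \<subseteq> exps" "x = L.lincomb S c L.mon"
proof -
  have mc: "L.mon \<in> S \<rightarrow> carrier L" for S by auto
  have "\<exists>S c. finite S \<and> S \<subseteq> exps \<and> x = L.lincomb S c L.mon"
    using assms
  proof (induction rule: L_induct)
    case (word w)
    obtain a where "L.prop_to (proj (word w)) (L.mon a)" using proj_word_mon[OF word] by blast
    then obtain b where b: "b \<in> exps" "L.prop_to (proj (word w)) (L.mon b)"
      using mon_restrict[of a] by auto
    then obtain c where "proj (word w) = c \<odot>\<^bsub>L\<^esub> L.mon b" unfolding L.prop_to_def by blast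
    then have "proj (word w) = L.lincomb {b} (\<lambda>_. c) L.mon"
      using L.lincomb_insert[of "{}" b L.mon "\<lambda>_. c"] mc by simp
    with b show ?case by (intro exI[of _ "{b}"]) auto
  next
    case (add x y)
    then obtain S c T d where S: "finite S" "S \<subseteq> exps" "x = L.lincomb S c L.mon"
      and T: "finite T" "T \<subseteq> exps" "y = L.lincomb T d L.mon" by blast
    \<comment> \<open>Both coefficient families are extended by zero, so that the sums can be added
      over the common index set.\<close>
    define c' where "c' a = (if a \<in> S then c a else 0)" for a
    define d' where "d' a = (if a \<in> T then d a else 0)" for a
    have "x = L.lincomb S c' L.mon"
      unfolding S(3) by (rule L.lincomb_cong) (auto simp: c'_def)
    also have "\<dots> = L.lincomb (S \<union> T) c' L.mon"
      by (rule L.lincomb_mono_neutral) (use S T in \<open>auto simp: c'_def\<close>)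
    finally have x: "x = L.lincomb (S \<union> T) c' L.mon" .
    have "y = L.lincomb T d' L.mon"
      unfolding T(3) by (rule L.lincomb_cong) (auto simp: d'_def)
    also have "\<dots> = L.lincomb (S \<union> T) d' L.mon"
      by (rule L.lincomb_mono_neutral) (use S T in \<open>auto simp: d'_def\<close>)
    finally have "x \<oplus>\<^bsub>L\<^esub> y = L.lincomb (S \<union> T) (\<lambda>a. c' a + d' a) L.mon"
      unfolding x by (simp only: L.lincomb_add[OF mc])
    moreover have "finite (S \<union> T)" "S \<union> T \<subseteq> exps" using S T by auto
    ultimately show ?case by blast
  next
    case (smult k x)
    then obtain S c where "finite S" "S \<subseteq> exps" "x = L.lincomb S c L.mon" by blast
    then show ?case using L.lincomb_smult[of S L.mon k c] mc by metis
  qed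
  with that show thesis by blast
qed

end

section \<open>The regular representation\<close>

lemma hom_Units:
  assumes "calgebra A" "calgebra B" "alg_hom A B k" "x \<in> Units A"
  shows "k x \<in> Units B" "k (inv\<^bsub>A\<^esub> x) = inv\<^bsub>B\<^esub> k x"
proof -
  interpret A: calgebra A by fact
  interpret B: calgebra B by fact
  note k = alg_homD[OF assms(3)]
  have x: "x \<in> carrier A" "inv\<^bsub>A\<^esub> x \<in> carrier A" using assms(4) by auto
  have *: "k x \<otimes>\<^bsub>B\<^esub> k (inv\<^bsub>A\<^esub> x) = \<one>\<^bsub>B\<^esub>" "k (inv\<^bsub>A\<^esub> x) \<otimes>\<^bsub>B\<^esub> k x = \<one>\<^bsub>B\<^esub>"
    using k(2)[OF x, symmetric] k(2)[OF x(2,1), symmetric] k(4) assms(4) by simp_all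
  then show "k x \<in> Units B" using k(1) x unfolding Units_def by blast
  show "k (inv\<^bsub>A\<^esub> x) = inv\<^bsub>B\<^esub> k x"
    using B.inv_unique'[OF k(1)[OF x(1)] k(1)[OF x(2)] *] .
qed

lemma hom_int_pow:
  assumes "calgebra A" "calgebra B" "alg_hom A B k" "x \<in> Units A"
  shows "k (x [^]\<^bsub>A\<^esub> (m::int)) = k x [^]\<^bsub>B\<^esub> m"
proof -
  interpret A: calgebra A by fact
  interpret B: calgebra B by fact
  note k = alg_homD[OF assms(3)]
  have x: "x \<in> carrier A" using assms(4) by auto
  have nat: "k (x [^]\<^bsub>A\<^esub> j) = k x [^]\<^bsub>B\<^esub> j" for j :: nat
    using k(2)[OF A.nat_pow_closed[OF x] x] k(4) by (induction j) simp_all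
  show ?thesis
    using hom_Units(2)[OF assms(1-3) A.Units_nat_pow_closed[OF assms(4)]]
    unfolding int_pow_def2 by (simp only: nat split: if_split) simp
qed

lemma hom_ordered_monomial:
  assumes "calgebra A" "calgebra B" "alg_hom A B k" "u \<in> set js \<rightarrow> Units A"
  shows "k (calgebra.ordered_monomial A u js a) = calgebra.ordered_monomial B (\<lambda>i. k (u i)) js a"
proof -
  interpret A: calgebra A by fact
  interpret B: calgebra B by fact
  note k = alg_homD[OF assms(3)]
  show ?thesis using assms(4)
  proof (induction js)
    case (Cons j js)
    then have "u j \<in> Units A" and u: "u \<in> set js \<rightarrow> Units A" by auto
    then have "u j [^]\<^bsub>A\<^esub> a j \<in> carrier A" "A.ordered_monomial u js a \<in> carrier A"
      using A.ordered_monomial_Units by blast+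
    with Cons.IH[OF u] show ?case
      by (simp add: k(2) hom_int_pow[OF assms(1-3) \<open>u j \<in> Units A\<close>])
  qed (simp add: k(4))
qed

text \<open>Linear operators on all functions, with no support condition: weighted shifts are given
  there by pointwise formulas, and applying them to the delta function at the origin recovers
  coefficients.\<close>

definition endo_algebra :: "(complex, ('e \<Rightarrow> complex) \<Rightarrow> 'e \<Rightarrow> complex) module" where
  "endo_algebra =
    \<lparr>carrier = {T. (\<forall>f g. T (\<lambda>e. f e + g e) = (\<lambda>e. T f e + T g e)) \<and>
                   (\<forall>c f. T (\<lambda>e. c * f e) = (\<lambda>e. c * T f e))},
     mult = (\<lambda>S T f. S (T f)), one = (\<lambda>f. f), zero = (\<lambda>f e. 0),
     add = (\<lambda>S T f e. S f e + T f e), smult = (\<lambda>c T f e. c * T f e)\<rparr>"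

lemma endo_algebra_simps:
  "S \<otimes>\<^bsub>endo_algebra\<^esub> T = (\<lambda>f. S (T f))"
  "S \<oplus>\<^bsub>endo_algebra\<^esub> T = (\<lambda>f e. S f e + T f e)"
  "\<one>\<^bsub>endo_algebra\<^esub> = (\<lambda>f. f)"
  "\<zero>\<^bsub>endo_algebra\<^esub> = (\<lambda>f e. 0)"
  "c \<odot>\<^bsub>endo_algebra\<^esub> T = (\<lambda>f e. c * T f e)"
  by (simp_all add: endo_algebra_def)

lemma endo_algebra_carrier:
  "T \<in> carrier endo_algebra \<longleftrightarrow>
    (\<forall>f g. T (\<lambda>e. f e + g e) = (\<lambda>e. T f e + T g e)) \<and>
    (\<forall>c f. T (\<lambda>e. c * f e) = (\<lambda>e. c * T f e))"
  by (simp add: endo_algebra_def)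

lemma endo_algebra_lin:
  assumes "T \<in> carrier endo_algebra"
  shows "T (\<lambda>e. f e + g e) = (\<lambda>e. T f e + T g e)" "T (\<lambda>e. c * f e) = (\<lambda>e. c * T f e)"
  using assms unfolding endo_algebra_carrier by blast+

lemma endo_algebra_closed:
  "S \<in> carrier endo_algebra \<Longrightarrow> T \<in> carrier endo_algebra \<Longrightarrow> (\<lambda>f. S (T f)) \<in> carrier endo_algebra"
  "S \<in> carrier endo_algebra \<Longrightarrow> T \<in> carrier endo_algebra \<Longrightarrow>
    (\<lambda>f e. S f e + T f e) \<in> carrier endo_algebra"
  "T \<in> carrier endo_algebra \<Longrightarrow> (\<lambda>f e. c * T f e) \<in> carrier endo_algebra"
  "(\<lambda>f. f) \<in> carrier endo_algebra" "(\<lambda>f e. 0) \<in> carrier endo_algebra"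
  unfolding endo_algebra_carrier by (simp_all add: algebra_simps)

lemma calgebra_endo_algebra: "calgebra endo_algebra"
proof (intro calgebra.intro calgebra_axioms.intro ringI abelian_groupI monoidI)
  fix T :: "('a \<Rightarrow> complex) \<Rightarrow> 'a \<Rightarrow> complex" assume "T \<in> carrier endo_algebra"
  then have "(\<lambda>f e. -1 * T f e) \<in> carrier endo_algebra" by (rule endo_algebra_closed(3))
  then show "\<exists>S\<in>carrier endo_algebra. S \<oplus>\<^bsub>endo_algebra\<^esub> T = \<zero>\<^bsub>endo_algebra\<^esub>"
    by (rule bexI[rotated]) (simp add: endo_algebra_simps)
qed (simp_all only: endo_algebra_simps endo_algebra_closed endo_algebra_lin ac_simps ring_distribs
    mult_1 add_0)

interpretation endo: calgebra endo_algebra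
  by (rule calgebra_endo_algebra)

lemma endo_lincomb:
  assumes "finite S" "v \<in> S \<rightarrow> carrier endo_algebra"
  shows "endo.lincomb S c v f e = (\<Sum>i\<in>S. c i * v i f e)"
  using assms
proof (induction S rule: finite_induct)
  case (insert i S)
  then have "v \<in> S \<rightarrow> carrier endo_algebra" by auto
  with insert show ?case by (simp add: endo.lincomb_insert endo_algebra_simps)
qed (simp add: endo_algebra_simps)

text \<open>Translation by \<open>d\<close> followed by multiplication with a nowhere vanishing
  weight. The weight stays existential, because only its non-vanishing matters for separating
  monomials.\<close>

definition wshift ::
  "(nat \<Rightarrow> int) \<Rightarrow> (((nat \<Rightarrow> int) \<Rightarrow> complex) \<Rightarrow> (nat \<Rightarrow> int) \<Rightarrow> complex) \<Rightarrow> bool" where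
  "wshift d T \<longleftrightarrow> (\<exists>w. (\<forall>e. w e \<noteq> 0) \<and> (\<forall>f e. T f e = w e * f (\<lambda>i. e i - d i)))"

lemma wshift_id: "wshift (\<lambda>_. 0) (\<lambda>f. f)"
  unfolding wshift_def by (intro exI[of _ "\<lambda>_. 1"]) simp

lemma wshift_comp:
  assumes "wshift d S" "wshift d' T"
  shows "wshift (\<lambda>i. d i + d' i) (\<lambda>f. S (T f))"
proof -
  obtain w where w: "\<forall>e. w e \<noteq> 0" "\<forall>f e. S f e = w e * f (\<lambda>i. e i - d i)"
    using assms(1) unfolding wshift_def by blast
  obtain w' where w': "\<forall>e. w' e \<noteq> 0" "\<forall>f e. T f e = w' e * f (\<lambda>i. e i - d' i)"
    using assms(2) unfolding wshift_def by blast
  show ?thesis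
    unfolding wshift_def using w w'
    by (intro exI[of _ "\<lambda>e. w e * w' (\<lambda>i. e i - d i)"]) (simp add: algebra_simps)
qed

text \<open>Reading \<open>S (T f) = f\<close> at the point \<open>e + d\<close> solves for
  \<open>T f e\<close>: the result is the opposite shift with reciprocal weight.\<close>

lemma wshift_inverse:
  assumes "wshift d S" "\<And>f. S (T f) = f"
  shows "wshift (\<lambda>i. - d i) T"
proof -
  obtain w where w: "\<forall>e. w e \<noteq> 0" "\<forall>f e. S f e = w e * f (\<lambda>i. e i - d i)"
    using assms(1) unfolding wshift_def by blast
  have "T f e = inverse (w (\<lambda>i. e i + d i)) * f (\<lambda>i. e i + d i)" for f e
  proof -
    have "w (\<lambda>i. e i + d i) * T f e = f (\<lambda>i. e i + d i)"
      using w(2)[rule_format, of "T f" "\<lambda>i. e i + d i"] assms(2) by simp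
    then show ?thesis using w(1)[rule_format, of "\<lambda>i. e i + d i"] by (simp add: field_simps)
  qed
  then show ?thesis
    unfolding wshift_def using w(1)
    by (intro exI[of _ "\<lambda>e. inverse (w (\<lambda>i. e i + d i))"]) simp
qed

lemma wshift_int_pow:
  assumes "wshift d T" "T \<in> Units endo_algebra"
  shows "wshift (\<lambda>i. m * d i) (T [^]\<^bsub>endo_algebra\<^esub> (m::int))"
proof -
  have nat: "wshift (\<lambda>i. int j * d i) (T [^]\<^bsub>endo_algebra\<^esub> j)" for j :: nat
  proof (induction j)
    case 0
    then show ?case using wshift_id by (simp add: endo_algebra_simps)
  next
    case (Suc j)
    then show ?case
      using wshift_comp[OF Suc assms(1)] by (simp add: endo_algebra_simps algebra_simps)
  qed
  show ?thesis
  proof (cases "m < 0")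
    case True
    let ?P = "T [^]\<^bsub>endo_algebra\<^esub> nat (- m)"
    have "?P \<otimes>\<^bsub>endo_algebra\<^esub> inv\<^bsub>endo_algebra\<^esub> ?P = \<one>\<^bsub>endo_algebra\<^esub>"
      using endo.Units_nat_pow_closed[OF assms(2)] by (rule endo.Units_r_inv)
    then have "?P ((inv\<^bsub>endo_algebra\<^esub> ?P) f) = f" for f
      unfolding endo_algebra_simps by metis
    with wshift_inverse[OF nat] have "wshift (\<lambda>i. - (int (nat (- m)) * d i)) (inv\<^bsub>endo_algebra\<^esub> ?P)"
      by blast
    then show ?thesis using True unfolding int_pow_def2 by simp
  next
    case False
    then show ?thesis using nat[of "nat m"] unfolding int_pow_def2 by simp
  qed
qed

lemma wshift_ordered_monomial:
  assumes "\<And>j. j \<in> set js \<Longrightarrow> wshift (\<lambda>i. if i = j then 1 else 0) (u j)"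
    "u \<in> set js \<rightarrow> Units endo_algebra" "distinct js"
  shows "wshift (\<lambda>i. if i \<in> set js then a i else 0) (endo.ordered_monomial u js a)"
  using assms
proof (induction js)
  case Nil
  then show ?case using wshift_id by (simp add: endo_algebra_simps)
next
  case (Cons j js)
  then have "wshift (\<lambda>i. a j * (if i = j then 1 else 0)) (u j [^]\<^bsub>endo_algebra\<^esub> a j)"
    by (intro wshift_int_pow) auto
  moreover have "wshift (\<lambda>i. if i \<in> set js then a i else 0) (endo.ordered_monomial u js a)"
    using Cons by auto
  ultimately have "wshift (\<lambda>i. a j * (if i = j then 1 else 0) + (if i \<in> set js then a i else 0))
      (endo.ordered_monomial u (j # js) a)"
    unfolding endo.ordered_monomial_simps endo_algebra_simps by (rule wshift_comp)
  moreover have "(\<lambda>i. a j * (if i = j then 1 else 0) + (if i \<in> set js then a i else 0)) =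
      (\<lambda>i. if i \<in> set (j # js) then a i else 0)"
    using Cons.prems(3) by auto
  ultimately show ?case by simp
qed

text \<open>Skew-symmetry is what makes the operators below satisfy the relations. A diagonal entry
  \<open>h\<close> with \<open>q powi h \<noteq> 1\<close> would already force 1 = 0, since the
  square of a generator is a unit.\<close>

locale skew_laurent = laurent +
  assumes H_skew: "i < n \<Longrightarrow> j < n \<Longrightarrow> H $$ (j, i) = - H $$ (i, j)"
begin

text \<open>
  The left regular representation, written on coefficient functions. The monomial basis is
  rescaled by half-integral powers of \<open>q\<close>, hence the square root, so that the formula for
  \<open>y\<^sub>i\<close> treats all generators alike, whatever the order of the factors in a monomial.
\<close>

definition pair :: "nat \<Rightarrow> (nat \<Rightarrow> int) \<Rightarrow> int" where
  "pair i a = (\<Sum>k<n. H $$ (i, k) * a k)"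

definition gen_op :: "nat \<Rightarrow> ((nat \<Rightarrow> int) \<Rightarrow> complex) \<Rightarrow> (nat \<Rightarrow> int) \<Rightarrow> complex" where
  "gen_op i f a = csqrt q powi pair i a * f (a(i := a i - 1))"

definition gen_op_inv :: "nat \<Rightarrow> ((nat \<Rightarrow> int) \<Rightarrow> complex) \<Rightarrow> (nat \<Rightarrow> int) \<Rightarrow> complex" where
  "gen_op_inv i f a = csqrt q powi (- pair i a) * f (a(i := a i + 1))"

declare q_nonzero [simp]

lemma pair_upd:
  assumes "j < n"
  shows "pair i (a(j := x)) = pair i a + H $$ (i, j) * (x - a j)"
proof -
  have "pair i (a(j := x)) = (\<Sum>k<n. H $$ (i, k) * a k + (if k = j then H $$ (i, j) * (x - a j) else 0))"
    unfolding pair_def by (intro sum.cong) (auto simp: algebra_simps)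
  then show ?thesis using assms by (simp add: pair_def sum.distrib)
qed

lemma H_diag: "i < n \<Longrightarrow> H $$ (i, i) = 0"
  using H_skew[of i i] by simp

lemma gen_op_closed: "gen_op i \<in> carrier endo_algebra" "gen_op_inv i \<in> carrier endo_algebra"
  unfolding endo_algebra_carrier gen_op_def gen_op_inv_def by (auto simp: algebra_simps)

lemma gen_op_Units:
  assumes "i < n"
  shows "gen_op i \<in> Units endo_algebra"
proof -
  \<comment> \<open>Shifting coordinate \<open>i\<close> does not change \<open>pair i\<close>, as
    the diagonal of \<open>H\<close> is zero; hence the two weights cancel.\<close>
  have "gen_op i (gen_op_inv i f) a = f a" "gen_op_inv i (gen_op i f) a = f a" for f a
    using assms by (simp_all add: gen_op_def gen_op_inv_def pair_upd H_diag power_int_minus)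
  then have "gen_op i \<otimes>\<^bsub>endo_algebra\<^esub> gen_op_inv i = \<one>\<^bsub>endo_algebra\<^esub>"
    "gen_op_inv i \<otimes>\<^bsub>endo_algebra\<^esub> gen_op i = \<one>\<^bsub>endo_algebra\<^esub>"
    unfolding endo_algebra_simps by (intro ext; simp only:)+
  then show ?thesis using gen_op_closed unfolding Units_def by blast
qed

lemma gen_op_qcomm:
  assumes i: "i < n" and j: "j < n"
  shows "endo.qcomm q (H $$ (i, j)) (gen_op i) (gen_op j)"
proof -
  have pq: "q powi k = csqrt q powi (2 * k)" for k
    by (simp add: power_int_mult)
  have "gen_op i (gen_op j f) a = q powi (H $$ (i, j)) * gen_op j (gen_op i f) a" for f a
  proof (cases "i = j")
    case True
    then show ?thesis using H_diag[OF i] by simp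
  next
    case False
    \<comment> \<open>The two orders of composition reach the same point, but the second weight is
      read after the first shift. This changes the exponent by plus or minus
      \<open>H $$ (i, j)\<close>, a total discrepancy of twice that entry in powers of the square
      root, that is, \<open>q powi (H $$ (i, j))\<close>.\<close>
    let ?b = "a(i := a i - 1, j := a j - 1)"
    have "gen_op i (gen_op j f) a = csqrt q powi (pair i a + pair j a + H $$ (i, j)) * f ?b"
      using i j False H_skew[OF i j]
      by (simp add: gen_op_def pair_upd power_int_add algebra_simps power_int_minus power_int_diff)
    moreover have "gen_op j (gen_op i f) a = csqrt q powi (pair i a + pair j a - H $$ (i, j)) * f ?b"
      using i j False fun_upd_twist[of i j a]
      by (simp add: gen_op_def pair_upd power_int_add algebra_simps power_int_minus power_int_diff)
    moreover have "csqrt q powi (pair i a + pair j a + H $$ (i, j)) =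
        csqrt q powi (2 * H $$ (i, j)) * csqrt q powi (pair i a + pair j a - H $$ (i, j))"
      by (subst power_int_add[symmetric]) (simp_all add: algebra_simps)
    ultimately show ?thesis by (simp only: pq mult.assoc)
  qed
  then show ?thesis unfolding endo.qcomm_def endo_algebra_simps by auto
qed

lemma qtuple_gen_op: "qtuple endo_algebra q n (\<lambda>i j. H $$ (i, j)) gen_op"
  by unfold_locales (simp_all add: q_nonzero gen_op_Units gen_op_qcomm)

lemma wshift_gen_op: "wshift (\<lambda>j. if j = i then 1 else 0) (gen_op i)"
proof -
  have "(\<lambda>j. a j - (if j = i then 1 else 0)) = a(i := a i - 1)" for a :: "nat \<Rightarrow> int" by auto
  then show ?thesis
    unfolding wshift_def gen_op_def by (intro exI[of _ "\<lambda>a. csqrt q powi pair i a"]) simp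
qed

text \<open>The interface for all later separation arguments: a monomial translates by its own
  exponent, with some non-zero weight.\<close>

lemma shift_representation:
  obtains \<Psi> w where "alg_hom L endo_algebra \<Psi>"
    "\<And>a e. a \<in> exps \<Longrightarrow> w a e \<noteq> 0"
    "\<And>a f e. a \<in> exps \<Longrightarrow> \<Psi> (L.mon a) f e = w a e * f (\<lambda>i. e i - a i)"
proof -
  obtain \<Psi> where \<Psi>: "alg_hom L endo_algebra \<Psi>" "\<And>i. i < n \<Longrightarrow> \<Psi> (gen i) = gen_op i"
    using hom_exists[OF qtuple_gen_op] by blast
  have "wshift a (\<Psi> (L.mon a))" if a: "a \<in> exps" for a
  proof -
    have "\<Psi> (L.mon a) = endo.ordered_monomial (\<lambda>i. \<Psi> (gen i)) [0..<n] a"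
      by (rule hom_ordered_monomial[OF L.calgebra_axioms endo.calgebra_axioms \<Psi>(1)])
        (auto intro: gen_Units)
    moreover have "wshift (\<lambda>i. if i \<in> set [0..<n] then a i else 0)
        (endo.ordered_monomial (\<lambda>i. \<Psi> (gen i)) [0..<n] a)"
      by (rule wshift_ordered_monomial) (auto simp: \<Psi>(2) wshift_gen_op gen_op_Units)
    moreover have "(\<lambda>i. if i \<in> set [0..<n] then a i else 0) = a"
      using a by (auto simp: exps_def)
    ultimately show ?thesis by simp
  qed
  then have "\<forall>a\<in>exps. \<exists>w. (\<forall>e. w e \<noteq> 0) \<and> (\<forall>f e. \<Psi> (L.mon a) f e = w e * f (\<lambda>i. e i - a i))"
    unfolding wshift_def by blast
  from bchoice[OF this] obtain w where
    "\<forall>a\<in>exps. (\<forall>e. w a e \<noteq> 0) \<and> (\<forall>f e. \<Psi> (L.mon a) f e = w a e * f (\<lambda>i. e i - a i))" by blast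
  with \<Psi>(1) that show thesis by blast
qed

end

section \<open>Units\<close>

context skew_laurent
begin

text \<open>The difference of two distinct exponents is the coefficient sequence of a non-zero
  polynomial. Finitely many such polynomials have finitely many roots in all, so some integer
  \<open>t\<close> avoids every one of them.\<close>

lemma exps_separating_functional:
  assumes "finite D" "D \<subseteq> exps"
  obtains t :: int where "inj_on (\<lambda>a. \<Sum>i<n. a i * t ^ i) D"
proof -
  define P where "P a b = (\<Sum>i<n. monom (a i - b i) i)" for a b :: "nat \<Rightarrow> int"
  have P_nonzero: "P a b \<noteq> 0" if ab: "a \<in> exps" "b \<in> exps" "a \<noteq> b" for a b
  proof -
    from ab(3) obtain j where j: "a j \<noteq> b j" by auto
    \<comment> \<open>Members of \<open>exps\<close> vanish from \<open>n\<close> on, so they differ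
      at a position recorded in \<open>P\<close>.\<close>
    have "j < n"
    proof (rule ccontr)
      assume "\<not> j < n"
      then have "a j = 0" "b j = 0" using ab(1,2) by (simp_all add: exps_def)
      with j show False by simp
    qed
    have "coeff (P a b) j = (\<Sum>i<n. if i = j then a j - b j else 0)"
      unfolding P_def coeff_sum coeff_monom by (intro sum.cong refl if_cong) simp_all
    also have "\<dots> = a j - b j" using \<open>j < n\<close> by simp
    finally have "coeff (P a b) j \<noteq> 0" using j by simp
    then show ?thesis by (rule contrapos_nn) simp
  qed
  define bad where "bad a b = {t. poly (P a b) t = 0}" for a b
  have "finite (bad a b)" if "a \<in> D" "b \<in> D - {a}" for a b
    unfolding bad_def
  proof (rule poly_roots_finite)
    show "P a b \<noteq> 0" using that assms(2) by (intro P_nonzero) auto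
  qed
  then have "finite (\<Union>a\<in>D. \<Union>b\<in>D - {a}. bad a b)" using assms(1) by simp
  from ex_new_if_finite[OF infinite_UNIV_int this]
  obtain t where t: "t \<notin> (\<Union>a\<in>D. \<Union>b\<in>D - {a}. bad a b)" ..
  have "inj_on (\<lambda>a. \<Sum>i<n. a i * t ^ i) D"
  proof (rule inj_onI, rule ccontr)
    fix a b assume ab: "a \<in> D" "b \<in> D" "(\<Sum>i<n. a i * t ^ i) = (\<Sum>i<n. b i * t ^ i)" "a \<noteq> b"
    have "poly (P a b) t = (\<Sum>i<n. a i * t ^ i) - (\<Sum>i<n. b i * t ^ i)"
      unfolding P_def poly_sum poly_monom left_diff_distrib by (rule sum_subtractf)
    then have "t \<in> bad a b" using ab(3) unfolding bad_def by simp
    with t ab(1,2,4) show False by blast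
  qed
  with that show thesis by blast
qed

lemma L_operator:
  assumes "alg_hom L endo_algebra \<Psi>"
    and "\<And>a f e. a \<in> exps \<Longrightarrow> \<Psi> (L.mon a) f e = w a e * f (\<lambda>i. e i - a i)"
    and "finite S" "S \<subseteq> exps"
  shows "\<Psi> (L.lincomb S c L.mon) f e = (\<Sum>a\<in>S. c a * (w a e * f (\<lambda>i. e i - a i)))"
proof -
  have m: "L.mon \<in> S \<rightarrow> carrier L" by auto
  have "(\<lambda>a. \<Psi> (L.mon a)) \<in> S \<rightarrow> carrier endo_algebra"
    using alg_homD(1)[OF assms(1)] by blast
  then have "\<Psi> (L.lincomb S c L.mon) f e = (\<Sum>a\<in>S. c a * \<Psi> (L.mon a) f e)"
    using endo_lincomb[OF assms(3)]
    by (simp add: alg_hom_lincomb[OF L.calgebra_axioms endo.calgebra_axioms assms(1,3) m])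
  also have "\<dots> = (\<Sum>a\<in>S. c a * (w a e * f (\<lambda>i. e i - a i)))"
    using assms(2,4) by (intro sum.cong) auto
  finally show ?thesis .
qed

text \<open>The operator of \<open>L.mon a\<close> turns the delta function at the origin into a
  non-zero multiple of the delta function at \<open>a\<close>, which reveals both the exponent and
  the scalar.\<close>

lemma mon_inj:
  assumes "a \<in> exps" "b \<in> exps" "c \<noteq> 0" "c \<odot>\<^bsub>L\<^esub> L.mon a = d \<odot>\<^bsub>L\<^esub> L.mon b"
  shows "a = b" "c = d"
proof -
  obtain \<Psi> w where \<Psi>: "alg_hom L endo_algebra \<Psi>" "\<And>a e. a \<in> exps \<Longrightarrow> w a e \<noteq> 0"
    "\<And>a f e. a \<in> exps \<Longrightarrow> \<Psi> (L.mon a) f e = w a e * f (\<lambda>i. e i - a i)"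
    using shift_representation by blast
  have op: "\<Psi> (c \<odot>\<^bsub>L\<^esub> L.mon a) f e = c * (w a e * f (\<lambda>i. e i - a i))" if "a \<in> exps" for c a f e
    using that \<Psi>(3) by (simp add: alg_homD(5)[OF \<Psi>(1)] endo_algebra_simps)
  let ?\<delta> = "\<lambda>e. if e = (\<lambda>_. 0) then 1 else 0"
  have eq: "c * (w a e * ?\<delta> (\<lambda>i. e i - a i)) = d * (w b e * ?\<delta> (\<lambda>i. e i - b i))" for e
    using op[OF assms(1), of c ?\<delta> e] op[OF assms(2), of d ?\<delta> e] assms(4) by simp
  have "(\<lambda>i. a i - b i) = (\<lambda>_. 0)"
    using eq[of a] assms(3) \<Psi>(2)[OF assms(1), of a] by (auto split: if_splits)
  then show "a = b" by (metis eq_iff_diff_eq_0 ext)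
  then show "c = d" using eq[of a] \<Psi>(2)[OF assms(1), of a] by simp
qed

text \<open>
  A linear functional that is injective on the exponents occurring in a unit and in its inverse
  orders them. The sum of the two greatest exponents arises in only one way in the product, so its
  coefficient there is non-zero and the sum vanishes; the same holds for the two least exponents.
  Hence the greatest and the least exponent of the unit coincide.
\<close>

lemma Units_L_monomial:
  assumes x: "x \<in> Units L"
  obtains a where "a \<in> exps" "L.prop_to x (L.mon a)"
proof -
  obtain \<Psi> w where \<Psi>: "alg_hom L endo_algebra \<Psi>" "\<And>a e. a \<in> exps \<Longrightarrow> w a e \<noteq> 0"
    "\<And>a f e. a \<in> exps \<Longrightarrow> \<Psi> (L.mon a) f e = w a e * f (\<lambda>i. e i - a i)"
    using shift_representation by blast
  have op: "\<Psi> (L.lincomb S c L.mon) f e = (\<Sum>a\<in>S. c a * (w a e * f (\<lambda>i. e i - a i)))"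
    if "finite S" "S \<subseteq> exps" for S c f e
    by (rule L_operator[OF \<Psi>(1) _ that]) (rule \<Psi>(3))
  \<comment> \<open>Zero coefficients are dropped, so that extreme elements of the index set really
    occur in the element.\<close>
  have span: "\<exists>S c. finite S \<and> S \<subseteq> exps \<and> (\<forall>a\<in>S. c a \<noteq> 0) \<and> z = L.lincomb S c L.mon"
    if z: "z \<in> carrier L" for z
  proof -
    obtain S c where S: "finite S" "S \<subseteq> exps" "z = L.lincomb S c L.mon" using L_span[OF z] .
    have "L.lincomb {a \<in> S. c a \<noteq> 0} c L.mon = L.lincomb S c L.mon"
      using S by (intro L.lincomb_mono_neutral) auto
    with S show ?thesis by (intro exI[of _ "{a \<in> S. c a \<noteq> 0}"] exI[of _ c]) auto
  qed
  have xc: "x \<in> carrier L" "inv\<^bsub>L\<^esub> x \<in> carrier L" using x by auto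
  obtain S c where S: "finite S" "S \<subseteq> exps" "\<And>a. a \<in> S \<Longrightarrow> c a \<noteq> 0" "x = L.lincomb S c L.mon"
    using span[OF xc(1)] by blast
  obtain T d where T: "finite T" "T \<subseteq> exps" "\<And>b. b \<in> T \<Longrightarrow> d b \<noteq> 0"
    "inv\<^bsub>L\<^esub> x = L.lincomb T d L.mon"
    using span[OF xc(2)] by blast
  define \<delta> :: "(nat \<Rightarrow> int) \<Rightarrow> complex" where "\<delta> e = (if e = (\<lambda>_. 0) then 1 else 0)" for e
  \<comment> \<open>The inverse of \<open>x\<close> written as a coefficient function. Applying the
    operator of \<open>x\<close> to it yields the delta function, which turns the equation in the
    algebra into a convolution identity of scalars.\<close>
  define g where "g = \<Psi> (inv\<^bsub>L\<^esub> x) \<delta>"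
  have "\<Psi> (x \<otimes>\<^bsub>L\<^esub> inv\<^bsub>L\<^esub> x) = \<Psi> x \<otimes>\<^bsub>endo_algebra\<^esub> \<Psi> (inv\<^bsub>L\<^esub> x)"
    by (rule alg_homD(2)[OF \<Psi>(1) xc])
  then have "\<Psi> x g = \<delta>"
    using x alg_homD(4)[OF \<Psi>(1)] unfolding g_def by (simp add: endo_algebra_simps) metis
  then have \<delta>: "\<delta> e = (\<Sum>a\<in>S. c a * (w a e * g (\<lambda>i. e i - a i)))" for e
    using op[OF S(1,2), of c g e] S(4) by simp
  have g: "g e = (\<Sum>b\<in>T. if b = e then d e * w e e else 0)" for e
  proof -
    have "g e = (\<Sum>b\<in>T. d b * (w b e * \<delta> (\<lambda>i. e i - b i)))"
      using op[OF T(1,2), of d \<delta> e] T(4) unfolding g_def by simp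
    also have "\<dots> = (\<Sum>b\<in>T. if b = e then d e * w e e else 0)"
    proof (intro sum.cong refl)
      fix b
      have "(\<lambda>i. e i - b i) = (\<lambda>_. 0) \<longleftrightarrow> b = e" by (auto simp: fun_eq_iff)
      then show "d b * (w b e * \<delta> (\<lambda>i. e i - b i)) = (if b = e then d e * w e e else 0)"
        by (simp add: \<delta>_def)
    qed
    finally show ?thesis .
  qed
  have g_zero: "g e = 0" if "e \<notin> T" for e
    using that unfolding g by (intro sum.neutral) auto
  have g_nonzero: "g e \<noteq> 0" if "e \<in> T" for e
    using that T \<Psi>(2) unfolding g by (auto simp: sum.delta)
  \<comment> \<open>If the sum of \<open>a\<close> and \<open>b\<close> arises in one way only, a
    single summand survives at that point, so the delta function is non-zero there and the sum is
    the origin.\<close>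
  have extreme: "(\<lambda>i. a i + b i) = (\<lambda>_. 0)"
    if ab: "a \<in> S" "b \<in> T" and uniq: "\<And>a' b'. a' \<in> S \<Longrightarrow> b' \<in> T \<Longrightarrow>
      (\<lambda>i. a' i + b' i) = (\<lambda>i. a i + b i) \<Longrightarrow> a' = a" for a b
  proof -
    let ?e = "\<lambda>i. a i + b i"
    have "c a' * (w a' ?e * g (\<lambda>i. ?e i - a' i)) = (if a' = a then c a * (w a ?e * g b) else 0)"
      if "a' \<in> S" for a'
    proof (cases "a' = a")
      case False
      have "(\<lambda>i. a' i + (?e i - a' i)) = ?e" by simp
      then have "(\<lambda>i. ?e i - a' i) \<notin> T" using uniq[OF that] False by blast
      then show ?thesis using g_zero False by simp
    qed simp
    then have "\<delta> ?e = (\<Sum>a'\<in>S. if a' = a then c a * (w a ?e * g b) else 0)"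
      unfolding \<delta> by (intro sum.cong) auto
    also have "\<dots> = c a * (w a ?e * g b)" using S ab by (auto simp: sum.delta)
    also have "\<dots> \<noteq> 0" using S ab g_nonzero \<Psi>(2) by auto
    finally show ?thesis by (auto simp: \<delta>_def split: if_splits)
  qed
  have "\<delta> (\<lambda>_. 0) \<noteq> 0" by (simp add: \<delta>_def)
  then have ne: "S \<noteq> {}" "T \<noteq> {}"
    using g_zero unfolding \<delta> by auto
  obtain t where t: "inj_on (\<lambda>a. \<Sum>i<n. a i * t ^ i) (S \<union> T)"
    using exps_separating_functional[of "S \<union> T"] S T by blast
  define l :: "(nat \<Rightarrow> int) \<Rightarrow> int" where "l a = (\<Sum>i<n. a i * t ^ i)" for a
  have inj: "a = b" if "a \<in> S \<union> T" "b \<in> S \<union> T" "l a = l b" for a b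
    using t that unfolding l_def inj_on_def by blast
  have l_add: "l (\<lambda>i. a i + b i) = l a + l b" for a b
    by (simp add: l_def sum.distrib distrib_right)
  have l_zero: "l (\<lambda>_. 0) = 0" by (simp add: l_def)
  have "finite (l ` S)" "l ` S \<noteq> {}" "finite (l ` T)" "l ` T \<noteq> {}" using S T ne by auto
  note m = Max_in[OF this(1,2)] Max_in[OF this(3,4)] Min_in[OF this(1,2)] Min_in[OF this(3,4)]
    Max_ge[OF this(1)] Max_ge[OF this(3)] Min_le[OF this(1)] Min_le[OF this(3)]
  obtain a1 where a1: "a1 \<in> S" "\<And>a. a \<in> S \<Longrightarrow> l a \<le> l a1" using m(1,5) by fastforce
  obtain b1 where b1: "b1 \<in> T" "\<And>b. b \<in> T \<Longrightarrow> l b \<le> l b1" using m(2,6) by fastforce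
  obtain a2 where a2: "a2 \<in> S" "\<And>a. a \<in> S \<Longrightarrow> l a2 \<le> l a" using m(3,7) by fastforce
  obtain b2 where b2: "b2 \<in> T" "\<And>b. b \<in> T \<Longrightarrow> l b2 \<le> l b" using m(4,8) by fastforce
  have "(\<lambda>i. a1 i + b1 i) = (\<lambda>_. 0)"
  proof (rule extreme[OF a1(1) b1(1)])
    fix a b assume ab: "a \<in> S" "b \<in> T" "(\<lambda>i. a i + b i) = (\<lambda>i. a1 i + b1 i)"
    then have "l a + l b = l a1 + l b1" by (metis l_add)
    then have "l a = l a1" using a1(2)[OF ab(1)] b1(2)[OF ab(2)] by linarith
    then show "a = a1" using inj ab(1) a1(1) by blast
  qed
  then have s1: "l a1 + l b1 = 0" by (metis l_add l_zero)
  have "(\<lambda>i. a2 i + b2 i) = (\<lambda>_. 0)"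
  proof (rule extreme[OF a2(1) b2(1)])
    fix a b assume ab: "a \<in> S" "b \<in> T" "(\<lambda>i. a i + b i) = (\<lambda>i. a2 i + b2 i)"
    then have "l a + l b = l a2 + l b2" by (metis l_add)
    then have "l a = l a2" using a2(2)[OF ab(1)] b2(2)[OF ab(2)] by linarith
    then show "a = a2" using inj ab(1) a2(1) by blast
  qed
  then have s2: "l a2 + l b2 = 0" by (metis l_add l_zero)
  \<comment> \<open>By \<open>s1\<close> and \<open>s2\<close>, the spread of \<open>l\<close> on
    \<open>S\<close> is the negative of its spread on \<open>T\<close>; both are non-negative, hence
    zero.\<close>
  have "a = a1" if "a \<in> S" for a
  proof -
    have "l a = l a1"
      using s1 s2 a1(2)[OF that] a2(2)[OF that] a1(2)[OF a2(1)] b1(2)[OF b2(1)] by linarith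
    then show ?thesis using inj that a1(1) by blast
  qed
  then have "S = {a1}" using a1(1) by blast
  then have "x = c a1 \<odot>\<^bsub>L\<^esub> L.mon a1"
    using S(4) L.lincomb_insert[of "{}" a1 L.mon c] by simp
  then have "L.prop_to x (L.mon a1)"
    using S(3)[OF a1(1)] by (simp add: L.prop_to_smult)
  with S(2) a1(1) that show thesis by blast
qed

end

section \<open>Integral matrices preserving the form\<close>

lemma smult_smult_mat: "a \<cdot>\<^sub>m (b \<cdot>\<^sub>m A) = (a * b) \<cdot>\<^sub>m (A :: 'a :: semiring_1 mat)"
  by (rule eq_matI) (simp_all add: mult.assoc)

lemma smult_one_mat: "1 \<cdot>\<^sub>m A = (A :: 'a :: semiring_1 mat)"
  by (rule eq_matI) simp_all

lemma invertible_mat_iff_det: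
  fixes A :: "'a :: field mat"
  assumes A: "A \<in> carrier_mat k k"
  shows "invertible_mat A \<longleftrightarrow> det A \<noteq> 0"
proof
  assume "invertible_mat A"
  then obtain B where B: "A * B = 1\<^sub>m k" "B * A = 1\<^sub>m (dim_row B)"
    using carrier_matD[OF A] unfolding invertible_mat_def inverts_mat_def by metis
  \<comment> \<open>\<open>invertible_mat\<close> does not state the shape of the inverse; it is
    read off the two identities.\<close>
  have "dim_col B = k" using arg_cong[OF B(1), of dim_col] by simp
  moreover have "dim_row B = k" using arg_cong[OF B(2), of dim_col] A by simp
  ultimately have "det A * det B = 1"
    using det_mult[OF A carrier_matI, of B] B(1) by simp
  then show "det A \<noteq> 0" by auto
next
  assume d: "det A \<noteq> 0"
  define B where "B = inverse (det A) \<cdot>\<^sub>m adj_mat A"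
  have B: "B \<in> carrier_mat k k" using adj_mat(1)[OF A] by (simp add: B_def)
  have i: "inverse (det A) * det A = 1" using d by simp
  have "A * B = 1\<^sub>m k" "B * A = 1\<^sub>m k"
    using mult_smult_distrib[OF A adj_mat(1)[OF A], of "inverse (det A)"]
      mult_smult_assoc_mat[OF adj_mat(1)[OF A] A, of "inverse (det A)"]
    by (simp_all only: B_def adj_mat(2,3)[OF A] smult_smult_mat i smult_one_mat)
  then have "inverts_mat A B" "inverts_mat B A"
    using carrier_matD[OF A] carrier_matD[OF B] by (simp_all only: inverts_mat_def)
  then show "invertible_mat A"
    using carrier_matD[OF A] unfolding invertible_mat_def by auto
qed

text \<open>The form is supported on the first block, so \<open>C\<close> and \<open>D\<close> only
  ever meet zero blocks and disappear.\<close>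

lemma four_block_congruence:
  fixes A :: "'a :: comm_ring_1 mat"
  assumes "A \<in> carrier_mat r r" "B \<in> carrier_mat r m" "C \<in> carrier_mat m r" "D \<in> carrier_mat m m"
    "S \<in> carrier_mat r r"
  shows "transpose_mat (four_block_mat A B C D) *
      four_block_mat S (0\<^sub>m r m) (0\<^sub>m m r) (0\<^sub>m m m) * four_block_mat A B C D =
    four_block_mat (transpose_mat A * S * A) (transpose_mat A * S * B)
      (transpose_mat B * S * A) (transpose_mat B * S * B)"
proof -
  have "transpose_mat (four_block_mat A B C D) * four_block_mat S (0\<^sub>m r m) (0\<^sub>m m r) (0\<^sub>m m m) =
      four_block_mat (transpose_mat A * S) (0\<^sub>m r m) (transpose_mat B * S) (0\<^sub>m m m)"
    using assms
    by (simp add: transpose_four_block_mat[of A r r B m C m D]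
        mult_four_block_mat[where ?nr1.0 = r and ?n1.0 = r and ?n2.0 = m and ?nr2.0 = m and ?nc1.0 = r and ?nc2.0 = m])
  then show ?thesis
    using assms
    by (simp add: mult_four_block_mat[where ?nr1.0 = r and ?n1.0 = r and ?n2.0 = m and ?nr2.0 = m and ?nc1.0 = r and ?nc2.0 = m])
qed

lemma four_block_mat_upper_inj:
  assumes "four_block_mat A B C D = four_block_mat A' B' C' D'"
    "A \<in> carrier_mat r r" "B \<in> carrier_mat r m" "D \<in> carrier_mat m m"
    "A' \<in> carrier_mat r r" "B' \<in> carrier_mat r m" "D' \<in> carrier_mat m m"
  shows "A = A'" "B = B'"
proof -
  have e: "four_block_mat A B C D $$ (i, j) = four_block_mat A' B' C' D' $$ (i, j)" for i j
    using assms(1) by simp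
  show "A = A'"
  proof (rule eq_matI)
    fix i j assume "i < dim_row A'" "j < dim_col A'"
    then show "A $$ (i, j) = A' $$ (i, j)" using e[of i j] assms(2-) by auto
  qed (use assms in auto)
  show "B = B'"
  proof (rule eq_matI)
    fix i j assume "i < dim_row B'" "j < dim_col B'"
    then show "B $$ (i, j) = B' $$ (i, j)" using e[of i "j + r"] assms(2-) by auto
  qed (use assms in auto)
qed

section \<open>The symplectic blocks and their determinant\<close>

lemma S_mat_carrier [simp]: "S_mat \<in> carrier_mat 2 2"
  unfolding S_mat_def mat_of_rows_list_def by (rule carrier_matI) simp_all

text \<open>The square of \<open>S_mat\<close> is minus the identity of size 2, so its determinant
  squares to 1.\<close>

lemma det_S_mat: "det S_mat \<noteq> 0"
proof -
  have S: "S_mat $$ (0, 0) = 0" "S_mat $$ (0, Suc 0) = 1" "S_mat $$ (Suc 0, 0) = - 1"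
    "S_mat $$ (Suc 0, Suc 0) = 0"
    by (simp_all add: S_mat_def mat_of_rows_list_def)
  have d: "dim_row S_mat = 2" "dim_col S_mat = 2" using S_mat_carrier by (simp_all only: carrier_matD)
  have "S_mat * S_mat = (-1) \<cdot>\<^sub>m 1\<^sub>m 2"
    by (rule eq_matI) (auto simp: d S scalar_prod_def less_2_cases_iff numeral_2_eq_2 less_Suc_eq)
  then have "det S_mat * det S_mat = 1"
    using det_mult[OF S_mat_carrier S_mat_carrier] by simp
  then show ?thesis by auto
qed

lemma Lambda_Cons:
  "Lambda (m # ms) = four_block_mat (m \<cdot>\<^sub>m S_mat) (0\<^sub>m 2 (dim_col (Lambda ms)))
    (0\<^sub>m (dim_row (Lambda ms)) 2) (Lambda ms)"
  using carrier_matD[OF S_mat_carrier] by (simp add: Lambda_def Let_def)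

lemma Lambda_carrier [simp]: "Lambda ms \<in> carrier_mat (2 * length ms) (2 * length ms)"
proof (induction ms)
  case Nil
  show ?case by (simp add: Lambda_def)
next
  case (Cons m ms)
  have "m \<cdot>\<^sub>m S_mat \<in> carrier_mat 2 2" by simp
  from four_block_carrier_mat[OF this Cons] show ?case
    unfolding Lambda_Cons by simp
qed

lemma det_Lambda:
  assumes "\<forall>m\<in>set ms. 0 < m"
  shows "det (Lambda ms) \<noteq> 0"
  using assms
proof (induction ms)
  case Nil
  show ?case by (simp add: Lambda_def)
next
  case (Cons m ms)
  have "det (Lambda (m # ms)) = det (m \<cdot>\<^sub>m S_mat) * det (Lambda ms)"
    unfolding Lambda_Cons carrier_matD[OF Lambda_carrier[of ms]]
    by (rule det_four_block_mat_upper_right_zero[where n = 2 and m = "2 * length ms"]) simp_all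
  then show ?case using Cons det_S_mat by (simp add: det_smult)
qed

text \<open>Translates the complex block description into preservation of the form over the
  integers. In the harder direction the upper blocks give A^T Lambda A = Lambda and A^T Lambda B =
  0; non-degeneracy of Lambda makes \<open>det A\<close> non-zero and forces \<open>B = 0\<close>,
  after which \<open>det D\<close> is non-zero because \<open>det M\<close> factors.\<close>

lemma Q_Z_iff:
  assumes n: "n = 2 * length ms + m" and pos: "\<forall>m\<in>set ms. 0 < m"
    and H: "H = four_block_mat (Lambda ms) (0\<^sub>m (2 * length ms) m) (0\<^sub>m m (2 * length ms)) (0\<^sub>m m m)"
  shows "M \<in> Q_Z n ms \<longleftrightarrow> M \<in> GL_Z n \<and> transpose_mat M * H * M = H"
proof -
  let ?r = "2 * length ms" and ?L = "Lambda ms"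
  let ?c = "map_mat complex_of_int"
  have L: "?L \<in> carrier_mat ?r ?r" by simp
  have nr: "n - ?r = m" using n by simp
  have Hc: "H \<in> carrier_mat n n"
    unfolding H n using four_block_carrier_mat[OF L, of "0\<^sub>m m m" m m] by simp
  have cH: "?c H = four_block_mat (?c ?L) (0\<^sub>m ?r m) (0\<^sub>m m ?r) (0\<^sub>m m m)"
    unfolding H by (subst map_four_block_mat[of _ ?r ?r _ m _ m])
      (auto intro!: cong_four_block_mat)
  show ?thesis
  proof
    assume MQ: "M \<in> Q_Z n ms"
    then have M: "M \<in> GL_Z n" "M \<in> carrier_mat n n" by (auto simp: Q_Z_def GL_Z_def)
    from MQ obtain A C D where A: "A \<in> Sp_C ms" and C: "C \<in> carrier_mat m ?r" and D: "D \<in> GL_C m"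
      and cM: "?c M = four_block_mat A (0\<^sub>m ?r m) C D"
      unfolding Q_Z_def Q_C_def Let_def nr by auto
    have Ac: "A \<in> carrier_mat ?r ?r" "transpose_mat A * ?c ?L * A = ?c ?L"
      using A by (auto simp: Sp_C_def GL_C_def)
    have Dc: "D \<in> carrier_mat m m" using D by (auto simp: GL_C_def)
    have cL: "?c ?L \<in> carrier_mat ?r ?r" by simp
    have z: "transpose_mat A * ?c ?L * 0\<^sub>m ?r m = 0\<^sub>m ?r m"
      "transpose_mat (0\<^sub>m ?r m) * ?c ?L * A = 0\<^sub>m m ?r"
      "transpose_mat (0\<^sub>m ?r m) * ?c ?L * 0\<^sub>m ?r m = 0\<^sub>m m m"
      using left_mult_zero_mat[OF cL, of m] left_mult_zero_mat[OF Ac(1), of m]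
        right_mult_zero_mat[of "transpose_mat A * ?c ?L" ?r ?r m] Ac(1) cL
        right_mult_zero_mat[OF zero_carrier_mat, of m ?r m]
      by (simp_all only: zero_transpose_mat mult_carrier_mat transpose_carrier_mat zero_carrier_mat)
    have "?c (transpose_mat M * H * M) = transpose_mat (?c M) * ?c H * ?c M"
      using M Hc by (simp add: of_int_hom.mat_hom_mult[of _ n n _ n] map_mat_transpose)
    also have "\<dots> = ?c H"
      unfolding cM cH four_block_congruence[OF Ac(1) zero_carrier_mat C Dc cL] Ac(2) z ..
    finally show "M \<in> GL_Z n \<and> transpose_mat M * H * M = H"
      using M of_int_hom.mat_hom_inj by blast
  next
    assume asm: "M \<in> GL_Z n \<and> transpose_mat M * H * M = H"
    then have M: "M \<in> carrier_mat n n" "det M \<noteq> 0" and pres: "transpose_mat M * H * M = H"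
      by (auto simp: GL_Z_def)
    obtain A B C D where "split_block M ?r ?r = (A, B, C, D)" by (metis prod_cases4)
    from split_block[OF this, of m m] M(1) n
    have blocks: "A \<in> carrier_mat ?r ?r" "B \<in> carrier_mat ?r m" "C \<in> carrier_mat m ?r"
      "D \<in> carrier_mat m m" and MB: "M = four_block_mat A B C D" by auto
    note eq = pres[unfolded MB H four_block_congruence[OF blocks L]]
    have t: "transpose_mat A \<in> carrier_mat ?r ?r" "transpose_mat B \<in> carrier_mat m ?r"
      using blocks by simp_all
    note c = mult_carrier_mat[OF mult_carrier_mat[OF t(1) L] blocks(1)]
      mult_carrier_mat[OF mult_carrier_mat[OF t(1) L] blocks(2)]
      mult_carrier_mat[OF mult_carrier_mat[OF t(2) L] blocks(2)]
    have AL: "transpose_mat A * ?L * A = ?L" "transpose_mat A * ?L * B = 0\<^sub>m ?r m"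
      using four_block_mat_upper_inj[OF eq c(1,2,3) L zero_carrier_mat zero_carrier_mat] .
    define N where "N = transpose_mat A * ?L"
    have N: "N \<in> carrier_mat ?r ?r" using blocks L by (simp add: N_def)
    have "det N * det A = det ?L"
      using det_mult[OF N blocks(1)] AL(1) by (simp add: N_def)
    then have dN: "det N \<noteq> 0" and dA: "det A \<noteq> 0" using det_Lambda[OF pos] by auto
    \<comment> \<open>\<open>N\<close> need not be invertible over the integers. The adjugate gives
      \<open>det N\<close> times \<open>B\<close> equal to zero, and a non-zero integer can be
      cancelled entrywise.\<close>
    have "adj_mat N * (N * B) = (adj_mat N * N) * B"
      using adj_mat(1)[OF N] N blocks by simp
    also have "\<dots> = det N \<cdot>\<^sub>m B"
      using adj_mat(3)[OF N] blocks by (simp add: mult_smult_assoc_mat[of _ ?r ?r])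
    finally have "det N \<cdot>\<^sub>m B = 0\<^sub>m ?r m"
      using AL(2) adj_mat(1)[OF N] by (simp add: N_def)
    then have "det N * B $$ (i, j) = 0" if "i < ?r" "j < m" for i j
      using that blocks(2) by (metis carrier_matD index_smult_mat(1) index_zero_mat(1))
    then have B0: "B = 0\<^sub>m ?r m"
      using dN blocks(2) by (intro eq_matI) auto
    have "det M = det A * det D"
      unfolding MB B0 using blocks by (intro det_four_block_mat_upper_right_zero) auto
    then have dD: "det D \<noteq> 0" using M(2) by auto
    have cM: "?c M = four_block_mat (?c A) (0\<^sub>m ?r m) (?c C) (?c D)"
      unfolding MB B0 using blocks
      by (subst map_four_block_mat[of _ ?r ?r _ m _ m]) (auto intro!: cong_four_block_mat)
    have GL: "?c X \<in> GL_C k" if "X \<in> carrier_mat k k" "det X \<noteq> 0" for X k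
      using that invertible_mat_iff_det[of "?c X" k] by (simp add: GL_C_def)
    have "transpose_mat (?c A) * ?c ?L * ?c A = ?c (transpose_mat A * ?L * A)"
      using blocks L by (simp add: of_int_hom.mat_hom_mult[of _ ?r ?r _ ?r] map_mat_transpose)
    then have "?c A \<in> Sp_C ms"
      using GL[OF blocks(1) dA] AL(1) by (simp add: Sp_C_def)
    moreover have "?c C \<in> carrier_mat m ?r" using blocks by simp
    ultimately have "?c M \<in> Q_C n ms"
      unfolding Q_C_def Let_def nr using GL[OF blocks(4) dD] GL[OF M] cM by blast
    then show "M \<in> Q_Z n ms" using asm by (simp add: Q_Z_def)
  qed
qed

text \<open>A determinant 1 or -1 is its own inverse, so the adjugate scaled by \<open>det M\<close>
  is an integral inverse.\<close>

lemma GL_Z_inverse: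
  assumes "M \<in> GL_Z n"
  obtains M' where "M' \<in> carrier_mat n n" "M * M' = 1\<^sub>m n" "M' * M = 1\<^sub>m n"
proof -
  have M: "M \<in> carrier_mat n n" and d: "det M * det M = 1" using assms by (auto simp: GL_Z_def)
  have "M * (det M \<cdot>\<^sub>m adj_mat M) = 1\<^sub>m n" "(det M \<cdot>\<^sub>m adj_mat M) * M = 1\<^sub>m n"
    using mult_smult_distrib[OF M adj_mat(1)[OF M], of "det M"]
      mult_smult_assoc_mat[OF adj_mat(1)[OF M] M, of "det M"]
    by (simp_all only: adj_mat(2,3)[OF M] smult_smult_mat d smult_one_mat)
  with adj_mat(1)[OF M] that show thesis by (metis smult_carrier_mat)
qed

lemma GL_Z_if_inverse:
  assumes "M \<in> carrier_mat n n" "M' \<in> carrier_mat n n" "M * M' = 1\<^sub>m n"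
  shows "M \<in> GL_Z n"
proof -
  have "det M * det M' = 1" using det_mult[OF assms(1,2)] assms(3) by simp
  then show ?thesis using assms(1) zmult_eq_1_iff by (auto simp: GL_Z_def)
qed

text \<open>Entries of the congruence are values of the form at columns of \<open>M\<close>, written
  as the double sum that occurs in \<open>qcomm_mon_mon\<close>.\<close>

lemma congruence_index:
  fixes M :: "'a :: comm_ring_1 mat"
  assumes "M \<in> carrier_mat n n" "H \<in> carrier_mat n n" "i < n" "j < n"
  shows "(transpose_mat M * H * M) $$ (i, j) =
    (\<Sum>k<n. \<Sum>l<n. M $$ (k, i) * M $$ (l, j) * H $$ (k, l))"
proof -
  have "(transpose_mat M * H * M) $$ (i, j) =
      (\<Sum>k<n. M $$ (k, i) * (\<Sum>l<n. H $$ (k, l) * M $$ (l, j)))"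
    using assms by (simp add: scalar_prod_def atLeast0LessThan)
  also have "\<dots> = (\<Sum>k<n. \<Sum>l<n. M $$ (k, i) * M $$ (l, j) * H $$ (k, l))"
    unfolding sum_distrib_left by (intro sum.cong refl) (simp only: mult_ac)
  finally show ?thesis .
qed

section \<open>Automorphisms\<close>

context calgebra
begin

lemma qcomm_smult:
  assumes "x \<in> carrier A" "y \<in> carrier A" "qcomm q k x y"
  shows "qcomm q k (c \<odot> x) (d \<odot> y)"
  using assms by (simp add: qcomm_def smult_mult_left smult_mult_right smult_smult mult_ac)

text \<open>Scalars are central and appear on both sides, so the relation depends only on the
  proportionality classes.\<close>

lemma qcomm_prop_to_cong:
  assumes "x \<in> carrier A" "y \<in> carrier A" "prop_to x x'" "prop_to y y'"
    "x' \<in> carrier A" "y' \<in> carrier A" "qcomm q k x y"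
  shows "qcomm q k x' y'"
proof -
  obtain c d where "x' = c \<odot> x" "y' = d \<odot> y"
    using prop_to_sym[OF assms(5,3)] prop_to_sym[OF assms(6,4)] unfolding prop_to_def by blast
  then show ?thesis using qcomm_smult assms by blast
qed

end

lemma hom_prop_to:
  assumes "alg_hom A B k" "calgebra A" "calgebra B" "y \<in> carrier A" "calgebra.prop_to A x y"
  shows "calgebra.prop_to B (k x) (k y)"
proof -
  interpret A: calgebra A by fact
  interpret B: calgebra B by fact
  obtain c where "c \<noteq> 0" "x = c \<odot>\<^bsub>A\<^esub> y" using assms(5) unfolding A.prop_to_def by blast
  then show ?thesis
    using alg_homD(5)[OF assms(1,4)] by (simp add: B.prop_to_smult)
qed

context qtuple
begin

lemma prop_to_mon_inv:
  assumes x: "x \<in> Units A" and xa: "prop_to x (mon a)"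
  shows "prop_to (inv x) (mon (\<lambda>i. - a i))"
proof -
  have c: "x \<in> carrier A" "inv x \<in> carrier A" using x by auto
  have "prop_to (mon a \<otimes> mon (\<lambda>i. - a i)) \<one>"
    using mon_add[of a "\<lambda>i. - a i"] mon_zero by simp
  moreover have "prop_to (x \<otimes> mon (\<lambda>i. - a i)) (mon a \<otimes> mon (\<lambda>i. - a i))"
    using xa by (rule prop_to_mult[OF mon_closed mon_closed _ prop_to_refl[OF mon_closed]])
  ultimately have "prop_to (x \<otimes> mon (\<lambda>i. - a i)) \<one>"
    by (blast intro: prop_to_trans[OF one_closed])
  from prop_to_mult[OF c(2) one_closed prop_to_refl[OF c(2)] this]
  have "prop_to (mon (\<lambda>i. - a i)) (inv x)"
    using x c by (simp add: m_assoc[symmetric])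
  then show ?thesis by (rule prop_to_sym[OF c(2)])
qed

lemma prop_to_mon_int_pow:
  assumes x: "x \<in> Units A" and xa: "prop_to x (mon a)"
  shows "prop_to (x [^] (m::int)) (mon (\<lambda>i. m * a i))"
proof -
  have xc: "x \<in> carrier A" using x by auto
  have nat: "prop_to (x [^] m) (mon (\<lambda>i. int m * a i))" for m :: nat
  proof (induction m)
    case 0
    show ?case using prop_to_refl[OF one_closed] mon_zero by simp
  next
    case (Suc m)
    have "prop_to (x [^] m \<otimes> x) (mon (\<lambda>i. int m * a i) \<otimes> mon a)"
      using prop_to_mult[OF mon_closed mon_closed Suc xa] .
    from prop_to_trans[OF mon_closed this mon_add] show ?case by (simp add: algebra_simps)
  qed
  show ?thesis
  proof (cases "m < 0")
    case True
    then show ?thesis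
      using prop_to_mon_inv[OF Units_nat_pow_closed[OF x] nat[of "nat (-m)"]]
      unfolding int_pow_def2 by simp
  next
    case False
    then show ?thesis using nat[of "nat m"] unfolding int_pow_def2 by simp
  qed
qed

text \<open>A monomial in elements that are themselves monomials up to scalars: the exponents
  combine as in a matrix-vector product.\<close>

lemma ordered_monomial_prop_to:
  assumes v: "v \<in> set js \<rightarrow> Units A"
    and M: "\<And>j. j \<in> set js \<Longrightarrow> prop_to (v j) (mon (M j))" and "distinct js"
  shows "prop_to (ordered_monomial v js a) (mon (\<lambda>i. \<Sum>j\<in>set js. a j * M j i))"
  using assms
proof (induction js)
  case Nil
  show ?case using prop_to_refl[OF one_closed] mon_zero by simp
next
  case (Cons j js)
  let ?s = "\<lambda>i. \<Sum>j\<in>set js. a j * M j i"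
  have "prop_to (v j [^] a j) (mon (\<lambda>i. a j * M j i))"
    using Cons.prems by (intro prop_to_mon_int_pow) auto
  moreover have "prop_to (ordered_monomial v js a) (mon ?s)"
    using Cons by auto
  ultimately have "prop_to (v j [^] a j \<otimes> ordered_monomial v js a) (mon (\<lambda>i. a j * M j i) \<otimes> mon ?s)"
    by (rule prop_to_mult[OF mon_closed mon_closed])
  from prop_to_trans[OF mon_closed this mon_add]
  show ?case using Cons.prems(3) by simp
qed

end

section \<open>Automorphisms attached to matrices\<close>

context laurent
begin

lemma algebra_Aut_iff:
  "\<phi> \<in> algebra_Aut L \<longleftrightarrow>
    \<phi> \<in> extensional (carrier L) \<and> alg_hom L L \<phi> \<and> bij_betw \<phi> (carrier L) (carrier L)"
  unfolding algebra_Aut_def alg_hom_def ring_iso_def by auto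

lemma algebra_Aut_eqI:
  assumes "\<phi> \<in> algebra_Aut L" "\<psi> \<in> algebra_Aut L" "\<And>i. i < n \<Longrightarrow> \<phi> (gen i) = \<psi> (gen i)"
  shows "\<phi> = \<psi>"
proof (rule extensionalityI[of _ "carrier L"])
  show "\<phi> \<in> extensional (carrier L)" "\<psi> \<in> extensional (carrier L)"
    using assms by (simp_all add: algebra_Aut_iff)
  have "alg_hom L L \<phi>" "alg_hom L L \<psi>"
    using assms(1,2) by (simp_all add: algebra_Aut_iff)
  then show "\<phi> x = \<psi> x" if "x \<in> carrier L" for x
    by (rule hom_unique[OF L.calgebra_axioms]) (use that assms(3) in auto)
qed

lemma alg_hom_restrict:
  assumes "alg_hom L L k"
  shows "alg_hom L L (restrict k (carrier L))"
  using assms by (auto simp: alg_hom_def Ring.ring_hom_def)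

lemma hom_mon_prop_to:
  assumes k: "alg_hom L L k"
    and M: "\<And>i. i < n \<Longrightarrow> L.prop_to (k (gen i)) (L.mon (\<lambda>l. M $$ (l, i)))"
  shows "L.prop_to (k (L.mon a)) (L.mon (\<lambda>l. \<Sum>i<n. M $$ (l, i) * a i))"
proof -
  have "k (L.mon a) = L.ordered_monomial (\<lambda>i. k (gen i)) [0..<n] a"
    by (rule hom_ordered_monomial[OF L.calgebra_axioms L.calgebra_axioms k]) (auto intro: gen_Units)
  moreover have "L.prop_to (L.ordered_monomial (\<lambda>i. k (gen i)) [0..<n] a)
      (L.mon (\<lambda>l. \<Sum>i\<in>set [0..<n]. a i * M $$ (l, i)))"
    using M hom_Units(1)[OF L.calgebra_axioms L.calgebra_axioms k] gen_Units
    by (intro L.ordered_monomial_prop_to) auto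
  ultimately show ?thesis by (simp add: atLeast0LessThan mult.commute)
qed

lemma mon_cong: "(\<And>i. i < n \<Longrightarrow> a i = b i) \<Longrightarrow> L.mon a = L.mon b"
  by (rule L.ordered_monomial_cong) auto

lemma mon_unit: "i < n \<Longrightarrow> L.mon (\<lambda>l. if l = i then 1 else 0) = gen i"
  using L.mon_unit_scaled[of i 1] L.Units_int_pow_1[OF gen_Units[of i]] by simp

lemma mon_one_mat: "i < n \<Longrightarrow> L.mon (\<lambda>l. 1\<^sub>m n $$ (l, i)) = gen i"
  using mon_cong[of "\<lambda>l. 1\<^sub>m n $$ (l, i)" "\<lambda>l. if l = i then 1 else 0"] mon_unit by simp

text \<open>Preservation of \<open>H\<close> says that the monomials of columns \<open>i\<close> and
  \<open>j\<close> commute with exponent \<open>H $$ (i, j)\<close>; scalar factors do not disturb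
  this, so the proposed images satisfy the relations.\<close>

lemma hom_of_matrix:
  assumes M: "M \<in> carrier_mat n n" "transpose_mat M * H * M = H"
    and c: "\<And>i. i < n \<Longrightarrow> c i \<noteq> 0"
  obtains k where "alg_hom L L k"
    "\<And>i. i < n \<Longrightarrow> k (gen i) = c i \<odot>\<^bsub>L\<^esub> L.mon (\<lambda>l. M $$ (l, i))"
proof -
  have "L.qcomm q (H $$ (i, j)) (L.mon (\<lambda>l. M $$ (l, i))) (L.mon (\<lambda>l. M $$ (l, j)))"
    if "i < n" "j < n" for i j
    using L.qcomm_mon_mon[of "\<lambda>l. M $$ (l, i)" "\<lambda>l. M $$ (l, j)"]
      congruence_index[OF M(1) H_dim that] M(2) by simp
  then have "qtuple L q n (\<lambda>i j. H $$ (i, j)) (\<lambda>i. c i \<odot>\<^bsub>L\<^esub> L.mon (\<lambda>l. M $$ (l, i)))"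
    using c by unfold_locales (auto simp: q_nonzero intro!: L.smult_Units L.qcomm_smult)
  from hom_exists[OF this] that show thesis by metis
qed

text \<open>The inverse is the diagonal map with reciprocal scalars, which exists as the
  identity-matrix case of \<open>hom_of_matrix\<close>.\<close>

lemma diagonal_hom_bij:
  assumes k: "alg_hom L L k" and d: "\<And>i. i < n \<Longrightarrow> L.prop_to (k (gen i)) (gen i)"
  shows "bij_betw k (carrier L) (carrier L)"
proof -
  have "\<forall>i. \<exists>c. i < n \<longrightarrow> c \<noteq> 0 \<and> k (gen i) = c \<odot>\<^bsub>L\<^esub> gen i"
    using d unfolding L.prop_to_def by blast
  then obtain c where c: "\<And>i. i < n \<Longrightarrow> c i \<noteq> 0" "\<And>i. i < n \<Longrightarrow> k (gen i) = c i \<odot>\<^bsub>L\<^esub> gen i"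
    by metis
  have one: "1\<^sub>m n \<in> carrier_mat n n" "transpose_mat (1\<^sub>m n) * H * 1\<^sub>m n = H"
    using H_dim by simp_all
  obtain s where s: "alg_hom L L s"
    "\<And>i. i < n \<Longrightarrow> s (gen i) = inverse (c i) \<odot>\<^bsub>L\<^esub> L.mon (\<lambda>l. 1\<^sub>m n $$ (l, i))"
    by (rule hom_of_matrix[OF one, of "\<lambda>i. inverse (c i)"]) (use c(1) in auto)
  have s_gen: "s (gen i) = inverse (c i) \<odot>\<^bsub>L\<^esub> gen i" if "i < n" for i
    using s(2)[OF that] mon_one_mat[OF that] by simp
  have id: "alg_hom L L (\<lambda>x. x)"
    unfolding alg_hom_def by (auto intro: ring_hom_memI)
  have sk: "s (k (gen i)) = gen i" "k (s (gen i)) = gen i" if "i < n" for i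
    using that c(1)[OF that]
    by (simp_all add: c(2) s_gen alg_homD(5)[OF k] alg_homD(5)[OF s(1)] L.smult_smult)
  have l: "s (k x) = x" if "x \<in> carrier L" for x
    by (rule hom_unique[OF L.calgebra_axioms alg_hom_comp[OF k s(1)] id sk(1) that])
  have r: "k (s x) = x" if "x \<in> carrier L" for x
    by (rule hom_unique[OF L.calgebra_axioms alg_hom_comp[OF s(1) k] id sk(2) that])
  show ?thesis
    by (rule bij_betw_byWitness[where f' = s]) (use l r alg_homD(1)[OF k] alg_homD(1)[OF s(1)] in auto)
qed

lemma mat_mult_exponents:
  assumes "M \<in> carrier_mat n n" "M' \<in> carrier_mat n n" "M * M' = 1\<^sub>m n" "i < n"
  shows "L.mon (\<lambda>l. \<Sum>j<n. M $$ (l, j) * M' $$ (j, i)) = gen i"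
proof -
  have "(M * M') $$ (l, i) = (\<Sum>j<n. M $$ (l, j) * M' $$ (j, i))" if "l < n" for l
    using assms(1,2,4) that by (simp add: scalar_prod_def atLeast0LessThan)
  then have "L.mon (\<lambda>l. \<Sum>j<n. M $$ (l, j) * M' $$ (j, i)) = L.mon (\<lambda>l. 1\<^sub>m n $$ (l, i))"
    unfolding assms(3) by (intro mon_cong) simp
  then show ?thesis using mon_one_mat[OF assms(4)] by simp
qed

text \<open>Composition multiplies exponent matrices, up to scalars that are not tracked.\<close>

lemma comp_diagonal:
  assumes k: "alg_hom L L k" "\<And>i. i < n \<Longrightarrow> L.prop_to (k (gen i)) (L.mon (\<lambda>l. M $$ (l, i)))"
    and k': "alg_hom L L k'" "\<And>i. i < n \<Longrightarrow> L.prop_to (k' (gen i)) (L.mon (\<lambda>l. M' $$ (l, i)))"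
    and M: "M \<in> carrier_mat n n" "M' \<in> carrier_mat n n" "M * M' = 1\<^sub>m n" and i: "i < n"
  shows "L.prop_to (k (k' (gen i))) (gen i)"
proof -
  have "L.prop_to (k (k' (gen i))) (k (L.mon (\<lambda>l. M' $$ (l, i))))"
    by (rule hom_prop_to[OF k(1) L.calgebra_axioms L.calgebra_axioms L.mon_closed k'(2)[OF i]])
  moreover have "L.prop_to (k (L.mon (\<lambda>l. M' $$ (l, i)))) (gen i)"
    using hom_mon_prop_to[OF k, of "\<lambda>l. M' $$ (l, i)"] mat_mult_exponents[OF M i] by simp
  ultimately show ?thesis using L.prop_to_trans gen_closed[OF i] by blast
qed

text \<open>With \<open>k'\<close> built from the inverse matrix, both composites of
  \<open>k\<close> and \<open>k'\<close> are diagonal, though not the identity in general. They are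
  bijective, so \<open>k\<close> is injective by one of them and surjective by the other.\<close>

lemma Aut_of_matrix:
  assumes M: "M \<in> GL_Z n" "transpose_mat M * H * M = H"
    and c: "\<And>i. i < n \<Longrightarrow> c i \<noteq> 0"
  obtains \<phi> where "\<phi> \<in> algebra_Aut L"
    "\<And>i. i < n \<Longrightarrow> \<phi> (gen i) = c i \<odot>\<^bsub>L\<^esub> L.mon (\<lambda>l. M $$ (l, i))"
proof -
  have Mc: "M \<in> carrier_mat n n" using M by (simp add: GL_Z_def)
  obtain M' where M': "M' \<in> carrier_mat n n" "M * M' = 1\<^sub>m n" "M' * M = 1\<^sub>m n"
    using GL_Z_inverse[OF M(1)] .
  have tr: "transpose_mat M \<in> carrier_mat n n" "transpose_mat M' \<in> carrier_mat n n"
    and tH: "transpose_mat M * H \<in> carrier_mat n n"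
    using Mc M'(1) H_dim by simp_all
  have tt: "transpose_mat M' * transpose_mat M = 1\<^sub>m n"
    using transpose_mult[OF Mc M'(1)] M'(2) by simp
  \<comment> \<open>The inverse matrix preserves \<open>H\<close> too: in the given identity
    \<open>M\<close> is cancelled on the right and its transpose on the left.\<close>
  have "H * M' = transpose_mat M * H"
    using assoc_mult_mat[OF tH Mc M'(1)] right_mult_one_mat[OF tH] by (simp only: M(2) M'(2))
  then have "transpose_mat M' * H * M' = transpose_mat M' * (transpose_mat M * H)"
    using assoc_mult_mat[OF tr(2) H_dim M'(1)] by (simp only:)
  also have "\<dots> = H"
    using assoc_mult_mat[OF tr(2,1) H_dim] left_mult_one_mat[OF H_dim] by (simp only: tt)
  finally have pres': "transpose_mat M' * H * M' = H" .
  obtain k where k: "alg_hom L L k"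
    "\<And>i. i < n \<Longrightarrow> k (gen i) = c i \<odot>\<^bsub>L\<^esub> L.mon (\<lambda>l. M $$ (l, i))"
    by (rule hom_of_matrix[OF Mc M(2), of c]) (use c in auto)
  obtain k' where k': "alg_hom L L k'"
    "\<And>i. i < n \<Longrightarrow> k' (gen i) = 1 \<odot>\<^bsub>L\<^esub> L.mon (\<lambda>l. M' $$ (l, i))"
    by (rule hom_of_matrix[OF M'(1) pres', of "\<lambda>_. 1"]) auto
  have p: "L.prop_to (k (gen i)) (L.mon (\<lambda>l. M $$ (l, i)))" if "i < n" for i
    using k(2)[OF that] c[OF that] by (simp add: L.prop_to_smult)
  have p': "L.prop_to (k' (gen i)) (L.mon (\<lambda>l. M' $$ (l, i)))" if "i < n" for i
    unfolding k'(2)[OF that] by (rule L.prop_to_smult) simp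
  have b1: "bij_betw (\<lambda>x. k (k' x)) (carrier L) (carrier L)"
    by (rule diagonal_hom_bij[OF alg_hom_comp[OF k'(1) k(1)]])
      (rule comp_diagonal[OF k(1) p k'(1) p' Mc M'(1,2)])
  have b2: "bij_betw (\<lambda>x. k' (k x)) (carrier L) (carrier L)"
    by (rule diagonal_hom_bij[OF alg_hom_comp[OF k(1) k'(1)]])
      (rule comp_diagonal[OF k'(1) p' k(1) p M'(1) Mc M'(3)])
  have "inj_on k (carrier L)"
  proof (rule inj_onI)
    fix x y assume "x \<in> carrier L" "y \<in> carrier L" "k x = k y"
    then show "x = y" using inj_onD[OF bij_betw_imp_inj_on[OF b2], of x y] by simp
  qed
  moreover have "carrier L \<subseteq> k ` carrier L"
  proof
    fix x assume "x \<in> carrier L"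
    then have "x \<in> (\<lambda>x. k (k' x)) ` carrier L"
      using bij_betw_imp_surj_on[OF b1] by simp
    then obtain y where y: "y \<in> carrier L" "x = k (k' y)" by (rule imageE) auto
    show "x \<in> k ` carrier L" unfolding y(2) by (rule imageI) (rule alg_homD(1)[OF k'(1) y(1)])
  qed
  moreover have "k ` carrier L \<subseteq> carrier L"
    using alg_homD(1)[OF k(1)] by (rule image_subsetI)
  ultimately have "bij_betw k (carrier L) (carrier L)"
    unfolding bij_betw_def by (intro conjI equalityI)
  then have "restrict k (carrier L) \<in> algebra_Aut L"
    using alg_hom_restrict[OF k(1)] by (simp add: algebra_Aut_iff)
  moreover have "restrict k (carrier L) (gen i) = c i \<odot>\<^bsub>L\<^esub> L.mon (\<lambda>l. M $$ (l, i))"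
    if "i < n" for i using k(2) that by simp
  ultimately show thesis using that by blast
qed

lemma Aut_inverse:
  assumes "\<phi> \<in> algebra_Aut L"
  obtains \<psi> where "\<psi> \<in> algebra_Aut L" "\<And>x. x \<in> carrier L \<Longrightarrow> \<phi> (\<psi> x) = x"
    "\<And>x. x \<in> carrier L \<Longrightarrow> \<psi> (\<phi> x) = x"
proof -
  \<comment> \<open>\<open>restrict\<close> supplies the extensionality that
    \<open>algebra_Aut\<close> demands.\<close>
  define \<psi> where "\<psi> = restrict (inv_into (carrier L) \<phi>) (carrier L)"
  have \<phi>: "alg_hom L L \<phi>" and bij: "bij_betw \<phi> (carrier L) (carrier L)"
    using assms by (simp_all add: algebra_Aut_iff)
  have r: "\<phi> (\<psi> x) = x" if "x \<in> carrier L" for x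
    using bij_betw_inv_into_right[OF bij that] that by (simp add: \<psi>_def)
  have l: "\<psi> (\<phi> x) = x" if "x \<in> carrier L" for x
    using bij_betw_inv_into_left[OF bij that] alg_homD(1)[OF \<phi> that] by (simp add: \<psi>_def)
  have c: "\<psi> x \<in> carrier L" if "x \<in> carrier L" for x
    using bij_betwE[OF bij_betw_inv_into[OF bij]] that by (simp add: \<psi>_def)
  have inj: "x = y" if "x \<in> carrier L" "y \<in> carrier L" "\<phi> x = \<phi> y" for x y
    using bij that unfolding bij_betw_def inj_on_def by blast
  have "alg_hom L L \<psi>"
    unfolding alg_hom_def
  proof (intro conjI ring_hom_memI allI ballI)
    fix x y assume x: "x \<in> carrier L" and y: "y \<in> carrier L"
    show "\<psi> (x \<otimes>\<^bsub>L\<^esub> y) = \<psi> x \<otimes>\<^bsub>L\<^esub> \<psi> y"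
      using alg_homD(2)[OF \<phi> c[OF x] c[OF y]] x y by - (rule inj, simp_all add: c r)
    show "\<psi> (x \<oplus>\<^bsub>L\<^esub> y) = \<psi> x \<oplus>\<^bsub>L\<^esub> \<psi> y"
      using alg_homD(3)[OF \<phi> c[OF x] c[OF y]] x y by - (rule inj, simp_all add: c r)
  next
    show "\<psi> \<one>\<^bsub>L\<^esub> = \<one>\<^bsub>L\<^esub>"
      using alg_homD(4)[OF \<phi>] by - (rule inj, simp_all add: c r)
  next
    fix a x assume x: "x \<in> carrier L"
    show "\<psi> (a \<odot>\<^bsub>L\<^esub> x) = a \<odot>\<^bsub>L\<^esub> \<psi> x"
      using alg_homD(5)[OF \<phi> c[OF x]] x by - (rule inj, simp_all add: c r)
  qed (rule c)
  moreover have "bij_betw \<psi> (carrier L) (carrier L)"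
    by (rule bij_betw_byWitness[where f' = \<phi>]) (use l r c alg_homD(1)[OF \<phi>] in auto)
  ultimately have "\<psi> \<in> algebra_Aut L"
    by (simp add: algebra_Aut_iff) (simp add: \<psi>_def)
  with r l that show thesis by blast
qed

lemma Aut_compose:
  assumes "\<phi> \<in> algebra_Aut L" "\<psi> \<in> algebra_Aut L"
  shows "compose (carrier L) \<phi> \<psi> \<in> algebra_Aut L"
proof -
  have h: "alg_hom L L \<phi>" "alg_hom L L \<psi>" using assms by (simp_all add: algebra_Aut_iff)
  have "alg_hom L L (compose (carrier L) \<phi> \<psi>)"
    using alg_hom_restrict[OF alg_hom_comp[OF h(2,1)]] by (simp add: compose_def restrict_def)
  moreover have "bij_betw (compose (carrier L) \<phi> \<psi>) (carrier L) (carrier L)"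
    using assms by (intro bij_betw_compose[of _ _ "carrier L"]) (simp_all add: algebra_Aut_iff)
  ultimately show ?thesis by (simp add: algebra_Aut_iff)
qed

end

section \<open>The matrix of an automorphism\<close>

context skew_laurent
begin

lemma mon_prop_to_inj:
  assumes "L.prop_to (L.mon a) (L.mon b)" "i < n"
  shows "a i = b i"
proof -
  let ?r = "\<lambda>a i. if i < n then a i else (0::int)"
  obtain c where "L.mon a = c \<odot>\<^bsub>L\<^esub> L.mon b" using assms(1) unfolding L.prop_to_def by blast
  moreover have "L.mon a = L.mon (?r a)" "L.mon b = L.mon (?r b)" by (rule mon_cong; simp)+
  ultimately have "1 \<odot>\<^bsub>L\<^esub> L.mon (?r a) = c \<odot>\<^bsub>L\<^esub> L.mon (?r b)" by simp
  from mon_inj(1)[OF _ _ _ this] have "?r a = ?r b" by (simp add: exps_def)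
  from fun_cong[OF this, of i] show ?thesis using assms(2) by simp
qed

text \<open>Here genericity enters: both powers of q scale the same non-zero multiple of one
  monomial, hence agree, and a power of q determines its integer exponent.\<close>

lemma qcomm_mon_unique:
  assumes generic: "\<forall>k>0. q ^ k \<noteq> 1"
    and "L.qcomm q k (L.mon a) (L.mon b)" "L.qcomm q l (L.mon a) (L.mon b)"
  shows "k = l"
proof -
  let ?c = "\<lambda>i. b i + a i"
  obtain e where e: "e \<in> exps" "L.mon ?c = L.mon e" using mon_restrict[of ?c] by blast
  obtain c where c: "c \<noteq> 0" "L.mon b \<otimes>\<^bsub>L\<^esub> L.mon a = c \<odot>\<^bsub>L\<^esub> L.mon e"
    using L.mon_add[of b a] e unfolding L.prop_to_def by auto
  have "(q powi k * c) \<odot>\<^bsub>L\<^esub> L.mon e = (q powi l * c) \<odot>\<^bsub>L\<^esub> L.mon e"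
    using assms(2,3) unfolding L.qcomm_def c(2) by (simp add: L.smult_smult)
  from mon_inj(2)[OF e(1) e(1) _ this] have eq: "q powi k = q powi l"
    using c(1) q_nonzero by simp
  \<comment> \<open>Genericity speaks of positive natural exponents; applying this to
    \<open>k - l\<close> and to \<open>l - k\<close> rules out both signs.\<close>
  have pos: "m \<le> 0" if "q powi m = 1" for m :: int
  proof (rule ccontr)
    assume "\<not> m \<le> 0"
    then have "q ^ nat m = 1" "nat m > 0" using that by (simp_all add: power_int_def)
    then show False using generic by blast
  qed
  have "q powi (k - l) = 1" "q powi (l - k) = 1"
    using eq q_nonzero by (simp_all add: power_int_diff)
  from pos[OF this(1)] pos[OF this(2)] show ?thesis by simp
qed

lemma Aut_matrix:
  assumes generic: "\<forall>k>0. q ^ k \<noteq> 1" and \<phi>: "\<phi> \<in> algebra_Aut L"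
  obtains M where "M \<in> GL_Z n" "transpose_mat M * H * M = H"
    "\<And>i. i < n \<Longrightarrow> L.prop_to (\<phi> (gen i)) (L.mon (\<lambda>l. M $$ (l, i)))"
proof -
  have exponents: "\<exists>M\<in>carrier_mat n n. \<forall>i<n. L.prop_to (\<phi> (gen i)) (L.mon (\<lambda>l. M $$ (l, i)))"
    if "\<phi> \<in> algebra_Aut L" for \<phi>
  proof -
    have hom: "alg_hom L L \<phi>" using that by (simp add: algebra_Aut_iff)
    have "\<exists>a. L.prop_to (\<phi> (gen i)) (L.mon a)" if "i < n" for i
      using Units_L_monomial[OF hom_Units(1)[OF L.calgebra_axioms L.calgebra_axioms hom gen_Units[OF that]]]
      by blast
    then obtain \<alpha> where \<alpha>: "\<And>i. i < n \<Longrightarrow> L.prop_to (\<phi> (gen i)) (L.mon (\<alpha> i))" by metis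
    define M where "M = mat n n (\<lambda>(l, i). \<alpha> i l)"
    have "L.mon (\<lambda>l. M $$ (l, i)) = L.mon (\<alpha> i)" if "i < n" for i
      using that by (intro mon_cong) (simp add: M_def)
    moreover have "M \<in> carrier_mat n n" by (simp add: M_def)
    ultimately show ?thesis using \<alpha> by (intro bexI[of _ M]) auto
  qed
  have hom: "alg_hom L L \<phi>" using \<phi> by (simp add: algebra_Aut_iff)
  obtain M where M: "M \<in> carrier_mat n n"
    "\<And>i. i < n \<Longrightarrow> L.prop_to (\<phi> (gen i)) (L.mon (\<lambda>l. M $$ (l, i)))"
    using exponents[OF \<phi>] by blast
  obtain \<psi> where \<psi>: "\<psi> \<in> algebra_Aut L" "\<And>x. x \<in> carrier L \<Longrightarrow> \<phi> (\<psi> x) = x"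
    using Aut_inverse[OF \<phi>] by metis
  have hom': "alg_hom L L \<psi>" using \<psi> by (simp add: algebra_Aut_iff)
  obtain M' where M': "M' \<in> carrier_mat n n"
    "\<And>i. i < n \<Longrightarrow> L.prop_to (\<psi> (gen i)) (L.mon (\<lambda>l. M' $$ (l, i)))"
    using exponents[OF \<psi>(1)] by blast
  have "M * M' = 1\<^sub>m n"
  proof (rule eq_matI)
    fix l i assume "l < dim_row (1\<^sub>m n)" "i < dim_col (1\<^sub>m n)"
    then have li: "l < n" "i < n" by auto
    have "L.prop_to (\<phi> (\<psi> (gen i))) (\<phi> (L.mon (\<lambda>l. M' $$ (l, i))))"
      by (rule hom_prop_to[OF hom L.calgebra_axioms L.calgebra_axioms L.mon_closed M'(2)[OF li(2)]])
    from L.prop_to_trans[OF L.mon_closed this hom_mon_prop_to[OF hom M(2)]]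
    have "L.prop_to (gen i) (L.mon (\<lambda>l. \<Sum>j<n. M $$ (l, j) * M' $$ (j, i)))"
      using \<psi>(2) gen_closed li(2) by simp
    then have "L.prop_to (L.mon (\<lambda>l. if l = i then 1 else 0))
        (L.mon (\<lambda>l. \<Sum>j<n. M $$ (l, j) * M' $$ (j, i)))"
      using mon_unit[OF li(2)] by simp
    from mon_prop_to_inj[OF this li(1)] show "(M * M') $$ (l, i) = 1\<^sub>m n $$ (l, i)"
      using M(1) M'(1) li by (simp add: scalar_prod_def atLeast0LessThan)
  qed (use M M' in auto)
  then have GL: "M \<in> GL_Z n" by (rule GL_Z_if_inverse[OF M(1) M'(1)])
  have "transpose_mat M * H * M = H"
  proof (rule eq_matI)
    fix i j assume "i < dim_row H" "j < dim_col H"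
    then have ij: "i < n" "j < n" using H_dim by auto
    let ?a = "\<lambda>l. M $$ (l, i)" and ?b = "\<lambda>l. M $$ (l, j)"
    have c: "\<phi> (gen i) \<in> carrier L" "\<phi> (gen j) \<in> carrier L"
      using alg_homD(1)[OF hom] ij by auto
    \<comment> \<open>Applying \<open>\<phi>\<close> to the relation keeps its exponent, while the
      exponent computed from the image monomials is the form at two columns of
      \<open>M\<close>.\<close>
    have "L.qcomm q (H $$ (i, j)) (\<phi> (gen i)) (\<phi> (gen j))"
      using arg_cong[OF gen_qcomm[OF ij, unfolded L.qcomm_def], of \<phi>] ij
      by (simp add: L.qcomm_def alg_homD(2,5)[OF hom])
    from L.qcomm_prop_to_cong[OF c M(2)[OF ij(1)] M(2)[OF ij(2)] L.mon_closed L.mon_closed this]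
    have "H $$ (i, j) = (\<Sum>k<n. \<Sum>l<n. ?a k * ?b l * H $$ (k, l))"
      using qcomm_mon_unique[OF generic _ L.qcomm_mon_mon] by blast
    then show "(transpose_mat M * H * M) $$ (i, j) = H $$ (i, j)"
      using congruence_index[OF M(1) H_dim ij] by simp
  qed (use M H_dim in auto)
  with GL M(2) that show thesis by blast
qed

text \<open>The last clause covers every pair of automorphisms with the prescribed values on
  generators, so that it applies to those named by the definite descriptions
  \<open>tau_torus\<close> and \<open>tau_mat\<close>.\<close>

lemma Aut_factorization:
  assumes generic: "\<forall>k>0. q ^ k \<noteq> 1" and \<phi>: "\<phi> \<in> algebra_Aut L"
  obtains M c where "M \<in> GL_Z n" "transpose_mat M * H * M = H" "c \<in> complex_torus n"
    "\<And>\<sigma> \<tau>. \<sigma> \<in> algebra_Aut L \<Longrightarrow> \<tau> \<in> algebra_Aut L \<Longrightarrow>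
      (\<And>i. i < n \<Longrightarrow> \<sigma> (gen i) = (c $ i) \<odot>\<^bsub>L\<^esub> gen i) \<Longrightarrow>
      (\<And>i. i < n \<Longrightarrow> \<tau> (gen i) = L.mon (\<lambda>l. M $$ (l, i))) \<Longrightarrow>
      \<phi> = compose (carrier L) \<sigma> \<tau>"
proof -
  obtain M where M: "M \<in> GL_Z n" "transpose_mat M * H * M = H"
    "\<And>i. i < n \<Longrightarrow> L.prop_to (\<phi> (gen i)) (L.mon (\<lambda>l. M $$ (l, i)))"
    using Aut_matrix[OF generic \<phi>] by blast
  have Mc: "M \<in> carrier_mat n n" using M(1) by (simp add: GL_Z_def)
  obtain M' where M': "M' \<in> carrier_mat n n" "M * M' = 1\<^sub>m n" using GL_Z_inverse[OF M(1)] by metis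
  obtain \<tau> where \<tau>: "\<tau> \<in> algebra_Aut L" "\<And>i. i < n \<Longrightarrow> \<tau> (gen i) = 1 \<odot>\<^bsub>L\<^esub> L.mon (\<lambda>l. M $$ (l, i))"
    using Aut_of_matrix[OF M(1,2), of "\<lambda>_. 1"] by (metis zero_neq_one)
  have \<tau>_gen: "\<tau> (gen i) = L.mon (\<lambda>l. M $$ (l, i))" if "i < n" for i
    using \<tau>(2)[OF that] by simp
  have \<tau>p: "L.prop_to (\<tau> (gen i)) (L.mon (\<lambda>l. M $$ (l, i)))" if "i < n" for i
    using \<tau>_gen[OF that] L.prop_to_refl by simp
  obtain \<rho> where \<rho>: "\<rho> \<in> algebra_Aut L" "\<And>x. x \<in> carrier L \<Longrightarrow> \<tau> (\<rho> x) = x"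
    "\<And>x. x \<in> carrier L \<Longrightarrow> \<rho> (\<tau> x) = x"
    using Aut_inverse[OF \<tau>(1)] by metis
  have h: "alg_hom L L \<phi>" "alg_hom L L \<tau>" "alg_hom L L \<rho>"
    using \<phi> \<tau> \<rho> by (simp_all add: algebra_Aut_iff)
  note hp = hom_prop_to[OF _ L.calgebra_axioms L.calgebra_axioms]
  \<comment> \<open>Up to scalars, \<open>\<tau>\<close> sends the monomial of column
    \<open>i\<close> of the inverse matrix to \<open>gen i\<close>. Thus \<open>\<rho>\<close> sends
    \<open>gen i\<close> back to that monomial, and \<open>\<phi>\<close>, having the same matrix as
    \<open>\<tau>\<close>, returns it to \<open>gen i\<close>.\<close>
  have diag: "L.prop_to (\<phi> (\<rho> (gen i))) (gen i)" if i: "i < n" for i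
  proof -
    let ?m = "L.mon (\<lambda>l. M' $$ (l, i))"
    have "L.prop_to (\<tau> ?m) (gen i)"
      using hom_mon_prop_to[OF h(2) \<tau>p, of "\<lambda>l. M' $$ (l, i)"] mat_mult_exponents[OF Mc M' i] by simp
    from hp[OF h(3) gen_closed[OF i] this] have "L.prop_to ?m (\<rho> (gen i))"
      using \<rho>(3)[OF L.mon_closed] by simp
    then have "L.prop_to (\<rho> (gen i)) ?m"
      using L.prop_to_sym alg_homD(1)[OF h(3) gen_closed[OF i]] by blast
    from hp[OF h(1) L.mon_closed this] have "L.prop_to (\<phi> (\<rho> (gen i))) (\<phi> ?m)" .
    moreover have "L.prop_to (\<phi> ?m) (gen i)"
      using hom_mon_prop_to[OF h(1) M(3), of "\<lambda>l. M' $$ (l, i)"] mat_mult_exponents[OF Mc M' i] by simp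
    ultimately show ?thesis using L.prop_to_trans gen_closed[OF i] by blast
  qed
  then have "\<forall>i. \<exists>d. i < n \<longrightarrow> d \<noteq> 0 \<and> \<phi> (\<rho> (gen i)) = d \<odot>\<^bsub>L\<^esub> gen i"
    unfolding L.prop_to_def by blast
  then obtain d where d: "\<And>i. i < n \<Longrightarrow> d i \<noteq> 0" "\<And>i. i < n \<Longrightarrow> \<phi> (\<rho> (gen i)) = d i \<odot>\<^bsub>L\<^esub> gen i"
    by metis
  have "\<phi> = compose (carrier L) \<sigma> \<tau>'"
    if \<sigma>: "\<sigma> \<in> algebra_Aut L" and \<tau>': "\<tau>' \<in> algebra_Aut L"
      and \<sigma>_gen: "\<And>i. i < n \<Longrightarrow> \<sigma> (gen i) = (vec n d $ i) \<odot>\<^bsub>L\<^esub> gen i"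
      and \<tau>'_gen: "\<And>i. i < n \<Longrightarrow> \<tau>' (gen i) = L.mon (\<lambda>l. M $$ (l, i))" for \<sigma> \<tau>'
  proof -
    have "\<tau>' = \<tau>" using algebra_Aut_eqI[OF \<tau>' \<tau>(1)] \<tau>_gen \<tau>'_gen by simp
    have "alg_hom L L \<sigma>" using \<sigma> by (simp add: algebra_Aut_iff)
    then have \<sigma>\<rho>: "\<phi> (\<rho> x) = \<sigma> x" if "x \<in> carrier L" for x
      by (rule hom_unique[OF L.calgebra_axioms alg_hom_comp[OF h(3,1)]])
        (use that in \<open>simp_all add: \<sigma>_gen d(2)\<close>)
    have "\<phi> (gen i) = compose (carrier L) \<sigma> \<tau>' (gen i)" if i: "i < n" for i
      using \<sigma>\<rho>[OF alg_homD(1)[OF h(2) gen_closed[OF i]]] \<rho>(3) i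
      unfolding \<open>\<tau>' = \<tau>\<close> by (simp add: compose_eq)
    then show ?thesis by (intro algebra_Aut_eqI \<phi> Aut_compose \<sigma> \<tau>')
  qed
  moreover have "vec n d \<in> complex_torus n" using d(1) by (simp add: complex_torus_def)
  ultimately show thesis using that[OF M(1,2)] by blast
qed

end

theorem theorem3p1:
  fixes q :: complex and H :: "int mat" and n r :: nat and ms :: "int list"
  assumes q_nonzero: "q \<noteq> 0"
    and q_generic: "\<forall>k>0. q ^ k \<noteq> 1"
    and H_dim: "H \<in> carrier_mat n n"
    and H_skew: "transpose_mat H = - H"
    and H_rank: "vec_space.rank n (map_mat complex_of_int H) = r"
    and ms_pos: "\<forall>m\<in>set ms. 0 < m"
    and ms_sorted: "sorted ms"
    and ms_length: "2 * length ms = r"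
    and H_canonical: "H = four_block_mat (Lambda ms) (0\<^sub>m r (n - r))
                            (0\<^sub>m (n - r) r) (0\<^sub>m (n - r) (n - r))"
  shows "(\<forall>c\<in>complex_torus n. \<exists>!\<phi>. is_tau_torus q H c \<phi>) \<and>
         (\<forall>M\<in>Q_Z n ms. \<exists>!\<phi>. is_tau_mat q H M \<phi>) \<and>
         algebra_Aut (quasi_laurent q H) =
           {compose (carrier (quasi_laurent q H)) (tau_torus q H c) (tau_mat q H M) | c M.
              c \<in> complex_torus n \<and> M \<in> Q_Z n ms}"
proof -
  have "H $$ (j, i) = - H $$ (i, j)" if "i < n" "j < n" for i j
    using arg_cong[OF H_skew, of "\<lambda>A. A $$ (i, j)"] that H_dim by simp
  then interpret skew_laurent q H n
    using q_nonzero H_dim by unfold_locales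
  have Q: "M \<in> Q_Z n ms \<longleftrightarrow> M \<in> GL_Z n \<and> transpose_mat M * H * M = H" for M
  proof (rule Q_Z_iff[OF _ ms_pos])
    \<comment> \<open>Subtraction is truncated, so \<open>r \<le> n\<close> has to be extracted from
      the size of the canonical form.\<close>
    have "dim_row H = r + (n - r)"
      using ms_length carrier_matD(1)[OF Lambda_carrier[of ms]] by (subst H_canonical) simp
    then show "n = 2 * length ms + (n - r)" using H_dim ms_length by simp
    show "H = four_block_mat (Lambda ms) (0\<^sub>m (2 * length ms) (n - r))
        (0\<^sub>m (n - r) (2 * length ms)) (0\<^sub>m (n - r) (n - r))"
      using H_canonical ms_length by simp
  qed
  have tau: "is_tau_mat q H M \<phi> \<longleftrightarrow>
      \<phi> \<in> algebra_Aut L \<and> (\<forall>i<n. \<phi> (gen i) = L.mon (\<lambda>l. M $$ (l, i)))" if "M \<in> Q_Z n ms" for M \<phi>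
  proof -
    have "M \<in> carrier_mat n n" using that Q by (simp add: GL_Z_def)
    then have "L.mon (\<lambda>l. col M i $ l) = L.mon (\<lambda>l. M $$ (l, i))" if "i < n" for i
      using that by (intro mon_cong) simp
    then show ?thesis by (auto simp: is_tau_mat_def laurent_monomial_eq)
  qed
  have ex1: "\<exists>!\<phi>. is_tau_torus q H c \<phi>" if c: "c \<in> complex_torus n" for c
  proof -
    \<comment> \<open>Torus automorphisms are the identity-matrix case of
      \<open>Aut_of_matrix\<close>.\<close>
    have I: "1\<^sub>m n \<in> GL_Z n" "transpose_mat (1\<^sub>m n) * H * 1\<^sub>m n = H"
      using H_dim by (simp_all add: GL_Z_def)
    obtain \<phi> where \<phi>: "\<phi> \<in> algebra_Aut L"
      "\<And>i. i < n \<Longrightarrow> \<phi> (gen i) = (c $ i) \<odot>\<^bsub>L\<^esub> L.mon (\<lambda>l. 1\<^sub>m n $$ (l, i))"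
      by (rule Aut_of_matrix[OF I, of "\<lambda>i. c $ i"]) (use c in \<open>auto simp: complex_torus_def\<close>)
    have "is_tau_torus q H c \<phi>"
      using \<phi> mon_one_mat by (simp add: is_tau_torus_def)
    moreover have "\<psi> = \<phi>" if "is_tau_torus q H c \<psi>" for \<psi>
      using algebra_Aut_eqI[of \<psi> \<phi>] that calculation by (simp add: is_tau_torus_def)
    ultimately show ?thesis by blast
  qed
  have ex2: "\<exists>!\<phi>. is_tau_mat q H M \<phi>" if M: "M \<in> Q_Z n ms" for M
  proof -
    obtain \<phi> where \<phi>: "\<phi> \<in> algebra_Aut L"
      "\<And>i. i < n \<Longrightarrow> \<phi> (gen i) = 1 \<odot>\<^bsub>L\<^esub> L.mon (\<lambda>l. M $$ (l, i))"
      using Aut_of_matrix[of M "\<lambda>_. 1"] M Q by (metis zero_neq_one)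
    then have "is_tau_mat q H M \<phi>" by (simp add: tau[OF M])
    moreover have "\<psi> = \<phi>" if "is_tau_mat q H M \<psi>" for \<psi>
      using algebra_Aut_eqI[of \<psi> \<phi>] that calculation by (simp add: tau[OF M])
    ultimately show ?thesis by blast
  qed
  have t1: "is_tau_torus q H c (tau_torus q H c)" if "c \<in> complex_torus n" for c
    unfolding tau_torus_def by (rule theI'[OF ex1[OF that]])
  have t2: "is_tau_mat q H M (tau_mat q H M)" if "M \<in> Q_Z n ms" for M
    unfolding tau_mat_def by (rule theI'[OF ex2[OF that]])
  have Aut: "algebra_Aut L = {compose (carrier L) (tau_torus q H c) (tau_mat q H M) | c M.
      c \<in> complex_torus n \<and> M \<in> Q_Z n ms}"
  proof (intro equalityI subsetI)
    fix \<phi> assume "\<phi> \<in> algebra_Aut L"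
    from Aut_factorization[OF q_generic this] obtain M c where
      M: "M \<in> GL_Z n" "transpose_mat M * H * M = H" and c: "c \<in> complex_torus n" and
      fact: "\<And>\<sigma> \<tau>. \<sigma> \<in> algebra_Aut L \<Longrightarrow> \<tau> \<in> algebra_Aut L \<Longrightarrow>
        (\<And>i. i < n \<Longrightarrow> \<sigma> (gen i) = (c $ i) \<odot>\<^bsub>L\<^esub> gen i) \<Longrightarrow>
        (\<And>i. i < n \<Longrightarrow> \<tau> (gen i) = L.mon (\<lambda>l. M $$ (l, i))) \<Longrightarrow>
        \<phi> = compose (carrier L) \<sigma> \<tau>"
      by blast
    have MQ: "M \<in> Q_Z n ms" using M Q by blast
    have "\<phi> = compose (carrier L) (tau_torus q H c) (tau_mat q H M)"
      using t1[OF c] t2[OF MQ] by (intro fact) (simp_all add: is_tau_torus_def tau[OF MQ])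
    then show "\<phi> \<in> {compose (carrier L) (tau_torus q H c) (tau_mat q H M) | c M.
        c \<in> complex_torus n \<and> M \<in> Q_Z n ms}" using c MQ by blast
  next
    fix \<phi> assume "\<phi> \<in> {compose (carrier L) (tau_torus q H c) (tau_mat q H M) | c M.
        c \<in> complex_torus n \<and> M \<in> Q_Z n ms}"
    then show "\<phi> \<in> algebra_Aut L"
    proof (elim CollectE exE conjE)
      fix c M
      assume c: "c \<in> complex_torus n" and M: "M \<in> Q_Z n ms"
        and \<phi>: "\<phi> = compose (carrier L) (tau_torus q H c) (tau_mat q H M)"
      have "tau_torus q H c \<in> algebra_Aut L"
        using t1[OF c] unfolding is_tau_torus_def by (rule conjunct1)
      moreover have "tau_mat q H M \<in> algebra_Aut L"
        using t2[OF M] unfolding is_tau_mat_def by (rule conjunct1)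
      ultimately show ?thesis unfolding \<phi> by (rule Aut_compose)
    qed
  qed
  have torus: "\<forall>c\<in>complex_torus n. \<exists>!\<phi>. is_tau_torus q H c \<phi>"
    by (rule ballI) (rule ex1)
  have mat: "\<forall>M\<in>Q_Z n ms. \<exists>!\<phi>. is_tau_mat q H M \<phi>"
    by (rule ballI) (rule ex2)
  show ?thesis by (rule conjI[OF torus conjI[OF mat Aut]])
qed

end
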